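(* The category $\mathfrak{M}$ of multigraphs is complete, cocomplete, and regular. Every object of $\mathfrak{M}$ admits a partial morphism representer and an injective envelope. However, $\mathfrak{M}$ is not cartesian closed. The inclusion functor $N:\mathfrak{M}\to\mathfrak{H}$ fails to be continuous but admits a right adjoint functor (namely $\mathrm{Del}$), and the right adjoint $\mathrm{Del}:\mathfrak{H}\to\mathfrak{M}$ is not cocontinuous.
   Context: A set-system hypergraph $G$ consists of sets $V(G)$, $E(G)$ and a function $\epsilon_G:E(G)\to\mathcal{P}(V(G))$. A morphism $\phi:G\to H$ is a pair of functions $V(\phi)$, $E(\phi)$ with $\epsilon_H\circ E(\phi)=\mathcal{P}V(\phi)\circ\epsilon_G$, where $\mathcal{P}f(A)$ is the image of $A$. This forms the category $\mathfrak{H}$. A multigraph is a set-system hypergraph with $1\le|\epsilon_G(e)|\le 2$ for all edges $e$; $\mathfrak{M}$ is the full subcategory of $\mathfrak{H}$ on multigraphs and $N$ the inclusion. $\mathrm{Del}(H)$ is the multigraph with vertex set $V(H)$ and edge set $\{e\in E(H):1\le|\epsilon_H(e)|\le2\}$ with $\epsilon_H$ restricted. A partial morphism representer of $G$ is a monomorphism $\eta_G:G\to\tilde G$ such that for every span $K\xleftarrow{\phi}H\xrightarrow{\psi}G$ with $\phi$ monic there is a unique $\hat\psi:K\to\tilde G$ making the span a pullback of $\hat\psi$ and $\eta_G$. An injective envelope of $G$ is an essential monomorphism from $G$ into an injective object. A category is regular if it is finitely complete, kernel pairs have coequalizers, and regular epimorphisms are stable under pullback. *)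

theory Defs
  imports Main "HOL-Library.FuncSet"
begin

unbundle cardinal_syntax

section \<open>Categories and functors\<close>

record ('o, 'm) cat =
  Ob :: "'o set"
  Arr :: "'m set"
  Dom :: "'m \<Rightarrow> 'o"
  Cod :: "'m \<Rightarrow> 'o"
  Id :: "'o \<Rightarrow> 'm"
  Comp :: "'m \<Rightarrow> 'm \<Rightarrow> 'm"  (infixr \<open>\<cdot>\<index>\<close> 70)

definition Hom :: "('o, 'm, 'z) cat_scheme \<Rightarrow> 'o \<Rightarrow> 'o \<Rightarrow> 'm set" where
  "Hom C X Y = {f \<in> Arr C. Dom C f = X \<and> Cod C f = Y}"

locale category =
  fixes C :: "('o, 'm, 'z) cat_scheme" (structure)
  assumes Dom_Ob: "f \<in> Arr C \<Longrightarrow> Dom C f \<in> Ob C"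
    and Cod_Ob: "f \<in> Arr C \<Longrightarrow> Cod C f \<in> Ob C"
    and Id_Hom: "X \<in> Ob C \<Longrightarrow> Id C X \<in> Hom C X X"
    and Comp_Hom: "f \<in> Hom C X Y \<Longrightarrow> g \<in> Hom C Y Z \<Longrightarrow> g \<cdot> f \<in> Hom C X Z"
    and Comp_Id: "f \<in> Hom C X Y \<Longrightarrow> f \<cdot> Id C X = f"
    and Id_Comp: "f \<in> Hom C X Y \<Longrightarrow> Id C Y \<cdot> f = f"
    and Comp_assoc: "f \<in> Hom C W X \<Longrightarrow> g \<in> Hom C X Y \<Longrightarrow> h \<in> Hom C Y Z
          \<Longrightarrow> (h \<cdot> g) \<cdot> f = h \<cdot> (g \<cdot> f)"

definition full_subcategory :: "('o, 'm) cat \<Rightarrow> ('o \<Rightarrow> bool) \<Rightarrow> ('o, 'm) cat" where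
  "full_subcategory C P =
     C\<lparr>Ob := {X \<in> Ob C. P X}, Arr := {f \<in> Arr C. P (Dom C f) \<and> P (Cod C f)}\<rparr>"

record ('a, 'b, 'c, 'd) func =
  FO :: "'a \<Rightarrow> 'c"
  FA :: "'b \<Rightarrow> 'd"

locale is_functor =
  fixes C :: "('a, 'b) cat" and D :: "('c, 'd) cat" and F :: "('a, 'b, 'c, 'd) func"
  assumes category_dom: "category C" and category_cod: "category D"
    and FO_Ob: "X \<in> Ob C \<Longrightarrow> FO F X \<in> Ob D"
    and FA_Hom: "f \<in> Hom C X Y \<Longrightarrow> FA F f \<in> Hom D (FO F X) (FO F Y)"
    and FA_Id: "X \<in> Ob C \<Longrightarrow> FA F (Id C X) = Id D (FO F X)"
    and FA_Comp: "f \<in> Hom C X Y \<Longrightarrow> g \<in> Hom C Y Z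
          \<Longrightarrow> FA F (g \<cdot>\<^bsub>C\<^esub> f) = FA F g \<cdot>\<^bsub>D\<^esub> FA F f"

definition func_comp ::
  "('c, 'd, 'e, 'f) func \<Rightarrow> ('a, 'b, 'c, 'd) func \<Rightarrow> ('a, 'b, 'e, 'f) func" where
  "func_comp G F = \<lparr>FO = FO G \<circ> FO F, FA = FA G \<circ> FA F\<rparr>"

text \<open>\<^term>\<open>F\<close> is left adjoint to \<^term>\<open>G\<close>, by a natural bijection of hom-sets.\<close>

definition adjoint ::
  "('a, 'b) cat \<Rightarrow> ('c, 'd) cat \<Rightarrow> ('a, 'b, 'c, 'd) func \<Rightarrow> ('c, 'd, 'a, 'b) func \<Rightarrow> bool" where
  "adjoint C D F G \<longleftrightarrow> is_functor C D F \<and> is_functor D C G \<and>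
     (\<exists>\<Phi>. (\<forall>X\<in>Ob C. \<forall>Y\<in>Ob D. bij_betw (\<Phi> X Y) (Hom D (FO F X) Y) (Hom C X (FO G Y))) \<and>
          (\<forall>X\<in>Ob C. \<forall>X'\<in>Ob C. \<forall>Y\<in>Ob D. \<forall>Y'\<in>Ob D.
             \<forall>h\<in>Hom C X' X. \<forall>f\<in>Hom D (FO F X) Y. \<forall>k\<in>Hom D Y Y'.
               \<Phi> X' Y' (k \<cdot>\<^bsub>D\<^esub> f \<cdot>\<^bsub>D\<^esub> FA F h) = FA G k \<cdot>\<^bsub>C\<^esub> \<Phi> X Y f \<cdot>\<^bsub>C\<^esub> h))"


section \<open>Limits and colimits\<close>

definition is_cone ::
  "('i, 'j) cat \<Rightarrow> ('o, 'm) cat \<Rightarrow> ('i, 'j, 'o, 'm) func \<Rightarrow> 'o \<Rightarrow> ('i \<Rightarrow> 'm) \<Rightarrow> bool" where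
  "is_cone J C D X t \<longleftrightarrow> X \<in> Ob C \<and> (\<forall>i\<in>Ob J. t i \<in> Hom C X (FO D i)) \<and>
     (\<forall>a\<in>Arr J. FA D a \<cdot>\<^bsub>C\<^esub> t (Dom J a) = t (Cod J a))"

definition is_limit ::
  "('i, 'j) cat \<Rightarrow> ('o, 'm) cat \<Rightarrow> ('i, 'j, 'o, 'm) func \<Rightarrow> 'o \<Rightarrow> ('i \<Rightarrow> 'm) \<Rightarrow> bool" where
  "is_limit J C D X t \<longleftrightarrow> is_cone J C D X t \<and>
     (\<forall>Y s. is_cone J C D Y s \<longrightarrow> (\<exists>!u. u \<in> Hom C Y X \<and> (\<forall>i\<in>Ob J. t i \<cdot>\<^bsub>C\<^esub> u = s i)))"

definition is_cocone ::
  "('i, 'j) cat \<Rightarrow> ('o, 'm) cat \<Rightarrow> ('i, 'j, 'o, 'm) func \<Rightarrow> 'o \<Rightarrow> ('i \<Rightarrow> 'm) \<Rightarrow> bool" where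
  "is_cocone J C D X t \<longleftrightarrow> X \<in> Ob C \<and> (\<forall>i\<in>Ob J. t i \<in> Hom C (FO D i) X) \<and>
     (\<forall>a\<in>Arr J. t (Cod J a) \<cdot>\<^bsub>C\<^esub> FA D a = t (Dom J a))"

definition is_colimit ::
  "('i, 'j) cat \<Rightarrow> ('o, 'm) cat \<Rightarrow> ('i, 'j, 'o, 'm) func \<Rightarrow> 'o \<Rightarrow> ('i \<Rightarrow> 'm) \<Rightarrow> bool" where
  "is_colimit J C D X t \<longleftrightarrow> is_cocone J C D X t \<and>
     (\<forall>Y s. is_cocone J C D Y s \<longrightarrow> (\<exists>!u. u \<in> Hom C X Y \<and> (\<forall>i\<in>Ob J. u \<cdot>\<^bsub>C\<^esub> t i = s i)))"


section \<open>Smallness\<close>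

text \<open>
  A type \<^typ>\<open>'u\<close> plays the role of a Grothendieck universe: a set over it is small if its
  cardinality is less than that of the type, whose cardinality is required to be a regular
  strong limit.  Thus the cardinality is strongly inaccessible, or countable; in the latter case
  ``small'' means ``finite''.  Some such parameter is needed to speak of complete categories, as a
  category with all products indexed by its own set of arrows is a preorder.
\<close>

definition small :: "'u set \<Rightarrow> bool" where
  "small (A :: 'u set) \<longleftrightarrow> |A| <o |UNIV :: 'u set|"

definition universe_type :: "'u itself \<Rightarrow> bool" where
  "universe_type (_ :: 'u itself) \<longleftrightarrow>
     infinite (UNIV :: 'u set) \<and> regularCard |UNIV :: 'u set| \<and>
     (\<forall>A :: 'u set. small A \<longrightarrow> |Pow A| <o |UNIV :: 'u set| )"

definition small_category :: "('u, 'u) cat \<Rightarrow> bool" where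
  "small_category J \<longleftrightarrow> category J \<and> small (Ob J) \<and> small (Arr J)"

definition complete :: "'u itself \<Rightarrow> ('o, 'm) cat \<Rightarrow> bool" where
  "complete (_ :: 'u itself) C \<longleftrightarrow>
     (\<forall>(J :: ('u, 'u) cat) D. small_category J \<and> is_functor J C D \<longrightarrow> (\<exists>X t. is_limit J C D X t))"

definition cocomplete :: "'u itself \<Rightarrow> ('o, 'm) cat \<Rightarrow> bool" where
  "cocomplete (_ :: 'u itself) C \<longleftrightarrow>
     (\<forall>(J :: ('u, 'u) cat) D. small_category J \<and> is_functor J C D \<longrightarrow> (\<exists>X t. is_colimit J C D X t))"

definition finitely_complete :: "('o, 'm) cat \<Rightarrow> bool" where
  "finitely_complete C \<longleftrightarrow>
     (\<forall>(J :: (nat, nat) cat) D. category J \<and> finite (Ob J) \<and> finite (Arr J) \<and> is_functor J C D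
        \<longrightarrow> (\<exists>X t. is_limit J C D X t))"

definition continuous ::
  "'u itself \<Rightarrow> ('a, 'b) cat \<Rightarrow> ('c, 'd) cat \<Rightarrow> ('a, 'b, 'c, 'd) func \<Rightarrow> bool" where
  "continuous (_ :: 'u itself) C D F \<longleftrightarrow>
     (\<forall>(J :: ('u, 'u) cat) K X t. small_category J \<and> is_functor J C K \<and> is_limit J C K X t
        \<longrightarrow> is_limit J D (func_comp F K) (FO F X) (FA F \<circ> t))"

definition cocontinuous ::
  "'u itself \<Rightarrow> ('a, 'b) cat \<Rightarrow> ('c, 'd) cat \<Rightarrow> ('a, 'b, 'c, 'd) func \<Rightarrow> bool" where
  "cocontinuous (_ :: 'u itself) C D F \<longleftrightarrow>
     (\<forall>(J :: ('u, 'u) cat) K X t. small_category J \<and> is_functor J C K \<and> is_colimit J C K X t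
        \<longrightarrow> is_colimit J D (func_comp F K) (FO F X) (FA F \<circ> t))"


section \<open>Regular and cartesian closed categories\<close>

definition is_pullback :: "('o, 'm) cat \<Rightarrow> 'm \<Rightarrow> 'm \<Rightarrow> 'm \<Rightarrow> 'm \<Rightarrow> bool" where
  \<comment> \<open>the square \<open>f \<cdot> p = g \<cdot> q\<close> is a pullback of \<open>f\<close> and \<open>g\<close>\<close>
  "is_pullback C f g p q \<longleftrightarrow>
     f \<in> Arr C \<and> g \<in> Arr C \<and> Cod C f = Cod C g \<and> Dom C p = Dom C q \<and>
     p \<in> Hom C (Dom C p) (Dom C f) \<and> q \<in> Hom C (Dom C p) (Dom C g) \<and> f \<cdot>\<^bsub>C\<^esub> p = g \<cdot>\<^bsub>C\<^esub> q \<and>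
     (\<forall>X\<in>Ob C. \<forall>p'\<in>Hom C X (Dom C f). \<forall>q'\<in>Hom C X (Dom C g). f \<cdot>\<^bsub>C\<^esub> p' = g \<cdot>\<^bsub>C\<^esub> q' \<longrightarrow>
        (\<exists>!u. u \<in> Hom C X (Dom C p) \<and> p \<cdot>\<^bsub>C\<^esub> u = p' \<and> q \<cdot>\<^bsub>C\<^esub> u = q'))"

definition is_coequalizer :: "('o, 'm) cat \<Rightarrow> 'm \<Rightarrow> 'm \<Rightarrow> 'm \<Rightarrow> bool" where
  "is_coequalizer C f g e \<longleftrightarrow>
     f \<in> Arr C \<and> g \<in> Hom C (Dom C f) (Cod C f) \<and>
     e \<in> Hom C (Cod C f) (Cod C e) \<and> e \<cdot>\<^bsub>C\<^esub> f = e \<cdot>\<^bsub>C\<^esub> g \<and>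
     (\<forall>X\<in>Ob C. \<forall>h\<in>Hom C (Cod C f) X. h \<cdot>\<^bsub>C\<^esub> f = h \<cdot>\<^bsub>C\<^esub> g \<longrightarrow>
        (\<exists>!u. u \<in> Hom C (Cod C e) X \<and> u \<cdot>\<^bsub>C\<^esub> e = h))"

definition regular_epi :: "('o, 'm) cat \<Rightarrow> 'm \<Rightarrow> bool" where
  "regular_epi C e \<longleftrightarrow> (\<exists>f g. is_coequalizer C f g e)"

definition regular :: "('o, 'm) cat \<Rightarrow> bool" where
  "regular C \<longleftrightarrow> finitely_complete C \<and>
     (\<forall>f p q. is_pullback C f f p q \<longrightarrow> (\<exists>e. is_coequalizer C p q e)) \<and>
     (\<forall>f g p q. is_pullback C f g p q \<and> regular_epi C f \<longrightarrow> regular_epi C q)"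

definition is_terminal :: "('o, 'm) cat \<Rightarrow> 'o \<Rightarrow> bool" where
  "is_terminal C T \<longleftrightarrow> T \<in> Ob C \<and> (\<forall>X\<in>Ob C. \<exists>!u. u \<in> Hom C X T)"

definition is_product :: "('o, 'm) cat \<Rightarrow> 'o \<Rightarrow> 'o \<Rightarrow> 'o \<Rightarrow> 'm \<Rightarrow> 'm \<Rightarrow> bool" where
  "is_product C A B P p q \<longleftrightarrow> P \<in> Ob C \<and> p \<in> Hom C P A \<and> q \<in> Hom C P B \<and>
     (\<forall>X\<in>Ob C. \<forall>f\<in>Hom C X A. \<forall>g\<in>Hom C X B.
        \<exists>!u. u \<in> Hom C X P \<and> p \<cdot>\<^bsub>C\<^esub> u = f \<and> q \<cdot>\<^bsub>C\<^esub> u = g)"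

definition is_exponential ::
  "('o, 'm) cat \<Rightarrow> 'o \<Rightarrow> 'o \<Rightarrow> 'o \<Rightarrow> 'o \<Rightarrow> 'm \<Rightarrow> 'm \<Rightarrow> 'm \<Rightarrow> bool" where
  \<comment> \<open>\<open>E\<close> is \<open>B\<close> to the power \<open>A\<close>, with evaluation \<open>ev\<close> on the product \<open>P\<close> of \<open>E\<close> and \<open>A\<close>\<close>
  "is_exponential C A B E P p q ev \<longleftrightarrow>
     E \<in> Ob C \<and> is_product C E A P p q \<and> ev \<in> Hom C P B \<and>
     (\<forall>X\<in>Ob C. \<forall>Q p' q'. is_product C X A Q p' q' \<longrightarrow>
        (\<forall>f\<in>Hom C Q B. \<exists>!g. g \<in> Hom C X E \<and>
           (\<exists>u\<in>Hom C Q P. p \<cdot>\<^bsub>C\<^esub> u = g \<cdot>\<^bsub>C\<^esub> p' \<and> q \<cdot>\<^bsub>C\<^esub> u = q' \<and> ev \<cdot>\<^bsub>C\<^esub> u = f)))"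

definition cartesian_closed :: "('o, 'm) cat \<Rightarrow> bool" where
  "cartesian_closed C \<longleftrightarrow> (\<exists>T. is_terminal C T) \<and>
     (\<forall>A\<in>Ob C. \<forall>B\<in>Ob C. \<exists>P p q. is_product C A B P p q) \<and>
     (\<forall>A\<in>Ob C. \<forall>B\<in>Ob C. \<exists>E P p q ev. is_exponential C A B E P p q ev)"


section \<open>Partial morphism representers and injective envelopes\<close>

definition monic :: "('o, 'm) cat \<Rightarrow> 'm \<Rightarrow> bool" where
  "monic C m \<longleftrightarrow> m \<in> Arr C \<and>
     (\<forall>X\<in>Ob C. \<forall>f\<in>Hom C X (Dom C m). \<forall>g\<in>Hom C X (Dom C m). m \<cdot>\<^bsub>C\<^esub> f = m \<cdot>\<^bsub>C\<^esub> g \<longrightarrow> f = g)"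

definition partial_morphism_representer :: "('o, 'm) cat \<Rightarrow> 'o \<Rightarrow> 'm \<Rightarrow> bool" where
  "partial_morphism_representer C G \<eta> \<longleftrightarrow> monic C \<eta> \<and> Dom C \<eta> = G \<and>
     (\<forall>\<phi> \<psi>. monic C \<phi> \<and> \<psi> \<in> Hom C (Dom C \<phi>) G \<longrightarrow>
        (\<exists>!\<psi>'. \<psi>' \<in> Hom C (Cod C \<phi>) (Cod C \<eta>) \<and> is_pullback C \<psi>' \<eta> \<phi> \<psi>))"

definition essential_mono :: "('o, 'm) cat \<Rightarrow> 'm \<Rightarrow> bool" where
  "essential_mono C m \<longleftrightarrow> monic C m \<and>
     (\<forall>f\<in>Arr C. Dom C f = Cod C m \<and> monic C (f \<cdot>\<^bsub>C\<^esub> m) \<longrightarrow> monic C f)"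

definition injective :: "('o, 'm) cat \<Rightarrow> 'o \<Rightarrow> bool" where
  "injective C I \<longleftrightarrow> I \<in> Ob C \<and>
     (\<forall>m. monic C m \<longrightarrow> (\<forall>f\<in>Hom C (Dom C m) I. \<exists>g\<in>Hom C (Cod C m) I. g \<cdot>\<^bsub>C\<^esub> m = f))"

definition injective_envelope :: "('o, 'm) cat \<Rightarrow> 'o \<Rightarrow> 'm \<Rightarrow> bool" where
  "injective_envelope C G m \<longleftrightarrow> essential_mono C m \<and> Dom C m = G \<and> injective C (Cod C m)"


section \<open>Set-system hypergraphs and multigraphs\<close>

text \<open>
  Functions between carriers are extensional (\<^const>\<open>undefined\<close> off their domain), so that equality
  of records is equality of hypergraphs and of morphisms.
\<close>

record 'u hypergraph =
  verts :: "'u set"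
  edges :: "'u set"
  ends :: "'u \<Rightarrow> 'u set"

definition hypergraph :: "'u hypergraph \<Rightarrow> bool" where
  "hypergraph G \<longleftrightarrow> small (verts G) \<and> small (edges G) \<and> ends G \<in> edges G \<rightarrow>\<^sub>E Pow (verts G)"

record 'u hmor =
  src :: "'u hypergraph"
  tgt :: "'u hypergraph"
  vmap :: "'u \<Rightarrow> 'u"
  emap :: "'u \<Rightarrow> 'u"

definition hmorphism :: "'u hmor \<Rightarrow> bool" where
  "hmorphism \<phi> \<longleftrightarrow> hypergraph (src \<phi>) \<and> hypergraph (tgt \<phi>) \<and>
     vmap \<phi> \<in> verts (src \<phi>) \<rightarrow>\<^sub>E verts (tgt \<phi>) \<and>
     emap \<phi> \<in> edges (src \<phi>) \<rightarrow>\<^sub>E edges (tgt \<phi>) \<and>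
     (\<forall>e\<in>edges (src \<phi>). ends (tgt \<phi>) (emap \<phi> e) = vmap \<phi> ` ends (src \<phi>) e)"

definition Hyp :: "('u hypergraph, 'u hmor) cat" where
  "Hyp = \<lparr>Ob = {G. hypergraph G}, Arr = {\<phi>. hmorphism \<phi>}, Dom = src, Cod = tgt,
     Id = (\<lambda>G. \<lparr>src = G, tgt = G, vmap = (\<lambda>v\<in>verts G. v), emap = (\<lambda>e\<in>edges G. e)\<rparr>),
     Comp = (\<lambda>\<psi> \<phi>. \<lparr>src = src \<phi>, tgt = tgt \<psi>,
       vmap = compose (verts (src \<phi>)) (vmap \<psi>) (vmap \<phi>),
       emap = compose (edges (src \<phi>)) (emap \<psi>) (emap \<phi>)\<rparr>)\<rparr>"

text \<open>As \<^term>\<open>card A = 0\<close> for infinite \<^term>\<open>A\<close>, the condition below excludes infinite edges.\<close>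

definition multi_edge :: "'u set \<Rightarrow> bool" where
  "multi_edge A \<longleftrightarrow> 1 \<le> card A \<and> card A \<le> 2"

definition multigraph :: "'u hypergraph \<Rightarrow> bool" where
  "multigraph G \<longleftrightarrow> hypergraph G \<and> (\<forall>e\<in>edges G. multi_edge (ends G e))"

definition Mult :: "('u hypergraph, 'u hmor) cat" where
  "Mult = full_subcategory Hyp multigraph"

definition N :: "('u hypergraph, 'u hmor, 'u hypergraph, 'u hmor) func" where
  "N = \<lparr>FO = (\<lambda>G. G), FA = (\<lambda>\<phi>. \<phi>)\<rparr>"

definition del_edges :: "'u hypergraph \<Rightarrow> 'u set" where
  "del_edges H = {e \<in> edges H. multi_edge (ends H e)}"

definition del :: "'u hypergraph \<Rightarrow> 'u hypergraph" where
  "del H = \<lparr>verts = verts H, edges = del_edges H, ends = restrict (ends H) (del_edges H)\<rparr>"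

definition Del :: "('u hypergraph, 'u hmor, 'u hypergraph, 'u hmor) func" where
  "Del = \<lparr>FO = del, FA = (\<lambda>\<phi>. \<lparr>src = del (src \<phi>), tgt = del (tgt \<phi>),
     vmap = vmap \<phi>, emap = restrict (emap \<phi>) (del_edges (src \<phi>))\<rparr>)\<rparr>"


section \<open>Consistency of the definitions\<close>

lemma small_nat: "small (A :: nat set) \<longleftrightarrow> finite A"
  by (simp add: small_def finite_iff_ordLess_natLeq card_of_nat
      ordLess_ordIso_trans[OF _ card_of_nat] iffI
      ordLess_ordIso_trans[OF _ ordIso_symmetric[OF card_of_nat]])

lemma universe_type_nat: "universe_type TYPE(nat)"
proof -
  have "regularCard |UNIV :: nat set|"
    using regularCard_ordIso[OF ordIso_symmetric[OF card_of_nat]] natLeq_Cinfinite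
      regularCard_natLeq by blast
  moreover have "|Pow A| <o |UNIV :: nat set|" if "small A" for A :: "nat set"
    using that unfolding small_nat
    by (meson card_of_nat finite_Pow_iff finite_iff_ordLess_natLeq ordIso_symmetric
        ordLess_ordIso_trans)
  ultimately show ?thesis by (simp add: universe_type_def)
qed

lemma category_Hyp: "category Hyp"
proof (standard, goal_cases)
  case (3 X) then show ?case
    by (auto simp: Hyp_def Hom_def hmorphism_def hypergraph_def image_def)
next
  case (4 f X Y g Z) then show ?case
    by (auto simp: Hyp_def Hom_def hmorphism_def compose_def PiE_iff image_image Pi_iff
        hypergraph_def subset_iff intro!: image_cong)
next
  case (5 f X Y) then show ?case
    by (auto simp: Hyp_def Hom_def hmorphism_def compose_def PiE_iff extensional_def fun_eq_iff
        intro!: hmor.equality)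
next
  case (6 f X Y) then show ?case
    by (fastforce simp: Hyp_def Hom_def hmorphism_def compose_def PiE_iff extensional_def fun_eq_iff
        intro!: hmor.equality)
next
  case (7 f W X g Y h Z) then show ?case
    by (auto simp: Hyp_def Hom_def hmorphism_def compose_def PiE_iff fun_eq_iff
        intro!: hmor.equality)
qed (auto simp: Hyp_def hmorphism_def)

lemma category_full_subcategory:
  assumes "category C" shows "category (full_subcategory C P)"
proof -
  interpret category C by fact
  have H: "f \<in> Hom (full_subcategory C P) X Y \<longleftrightarrow> f \<in> Hom C X Y \<and> P X \<and> P Y" for f X Y
    by (auto simp: full_subcategory_def Hom_def)
  show ?thesis
    by standard (auto simp: H, auto simp: full_subcategory_def Dom_Ob Cod_Ob
        Id_Hom Comp_Hom Comp_Id Id_Comp Comp_assoc)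
qed

lemma category_Mult: "category Mult"
  by (simp add: Mult_def category_full_subcategory category_Hyp)

lemma is_functor_N: "is_functor Mult Hyp N"
  by (auto simp: is_functor_def category_Mult category_Hyp)
     (auto simp: N_def Mult_def full_subcategory_def Hom_def)

lemma multi_edge_image: "multi_edge A \<Longrightarrow> multi_edge (f ` A)"
  unfolding multi_edge_def
  by (metis One_nat_def Suc_leI card_eq_0_iff card_gt_0_iff card_image_le finite_imageI
      image_is_empty le_trans not_one_le_zero)

lemma small_subset: "small B \<Longrightarrow> A \<subseteq> B \<Longrightarrow> small A"
  unfolding small_def using card_of_mono1 ordLeq_ordLess_trans by blast

lemma multigraph_del: "hypergraph H \<Longrightarrow> multigraph (del H)"
  using small_subset[of "edges H" "del_edges H"]
  by (auto simp: multigraph_def hypergraph_def del_def del_edges_def)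

lemma hmorphism_Del: "hmorphism \<phi> \<Longrightarrow> hmorphism (FA Del \<phi>)"
  using multigraph_del[of "src \<phi>"] multigraph_del[of "tgt \<phi>"]
  by (auto simp: hmorphism_def multigraph_def Del_def del_def del_edges_def PiE_iff multi_edge_image)

lemma is_functor_Del: "is_functor Hyp Mult Del"
proof (rule is_functor.intro, goal_cases)
  case 1 show ?case by (rule category_Hyp)
next
  case 2 show ?case by (rule category_Mult)
next
  case (3 X) then show ?case
    using multigraph_del[of X]
    by (auto simp: Hyp_def Mult_def full_subcategory_def Del_def multigraph_def)
next
  case (4 f X Y)
  then have f: "hmorphism f" "src f = X" "tgt f = Y" by (auto simp: Hyp_def Hom_def)
  moreover have "multigraph (del X)" "multigraph (del Y)"
    using f by (auto simp: hmorphism_def intro!: multigraph_del)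
  ultimately show ?case
    using hmorphism_Del[of f] by (simp add: Hyp_def Mult_def full_subcategory_def Hom_def Del_def)
next
  case (5 X) then show ?case
    by (auto simp: Hyp_def Mult_def full_subcategory_def Del_def del_def del_edges_def fun_eq_iff)
next
  case (6 f X Y g Z) then show ?case
    by (auto simp: Hyp_def Mult_def full_subcategory_def Hom_def Del_def del_def del_edges_def
        compose_def fun_eq_iff hmorphism_def PiE_iff multi_edge_image)
qed

end

theory Submission
  imports Defs
begin

text \<open>
  A morphism out of a one-vertex graph is a vertex, and a morphism out of a graph with two vertices
  joined by an edge is an edge with an ordering of its ends.  These two probes detect monomorphisms
  (injective on vertices and edges) and make the elements of pullbacks and products visible; every
  span of edges over a common edge lifts to an edge of the pullback, hence the regular epimorphisms
  are the morphisms that are surjective on vertices and edges.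

  Colimits are computed componentwise, as are the vertices of limits; an edge of a limit is a
  compatible family of edges together with a set of at most two vertices that lies over all their
  ends.  Therefore the square of an edge has exactly two edges, the diagonal and the antidiagonal,
  with disjoint ends.  They become parallel when the first factor is contracted to a loop, where the
  product has only one edge: products do not preserve this quotient, so exponentials cannot exist.

  The functor \<^const>\<open>N\<close> does not preserve the terminal object, a loop, because no hyperedge without
  ends maps to it.  The functor \<^const>\<open>Del\<close> does not preserve the quotient of a hyperedge with three
  ends by the transposition of two of them: the quotient is an edge that has been deleted upstairs.
\<close>

section \<open>Small sets\<close>

text \<open>Carriers of objects of \<open>Mult\<close> must lie in the type \<open>'u\<close>, but
  limits, colimits and classifying graphs naturally have families, equivalence classes, options or
  sets as vertices and edges. Hence smallness is restated as \<open>usmall\<close> for sets over any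
  type, with \<open>U\<close> fixing the cardinal; each graph is built over whatever type suits it
  and carried into \<open>'u\<close> by injections. The hypotheses on the universe enter as closure
  properties: regularity gives small dependent sums, the strong limit property gives power sets and
  with them products. Representers and envelopes both arise by adding edges on prescribed sets of
  one or two vertices. A representer gets one extra vertex and a fresh edge on every such set,
  because an edge outside the domain of a partial morphism must stay apart from the edges of
  \<open>G\<close>. An envelope gets fresh edges only on sets that carry none, because an extra
  parallel edge could be collapsed onto an old one without disturbing \<open>G\<close>.\<close>

definition usmall :: "'u itself \<Rightarrow> 'a set \<Rightarrow> bool" where
  "usmall (_ :: 'u itself) A \<longleftrightarrow> |A| <o |UNIV :: 'u set|"

lemma usmall_subset: "usmall U B \<Longrightarrow> A \<subseteq> B \<Longrightarrow> usmall U A"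
  unfolding usmall_def using card_of_mono1 ordLeq_ordLess_trans by blast

lemma usmall_image: "usmall U A \<Longrightarrow> usmall U (f ` A)"
  unfolding usmall_def using card_of_image ordLeq_ordLess_trans by blast

lemma usmall_embed:
  fixes A :: "'a set"
  assumes "usmall TYPE('u) A"
  obtains f :: "'a \<Rightarrow> 'u" where "inj_on f A"
proof -
  have "|A| \<le>o |UNIV :: 'u set|"
    using assms ordLess_imp_ordLeq unfolding usmall_def by blast
  with that show ?thesis by (auto simp: card_of_ordLeq[symmetric])
qed

locale universe =
  fixes U :: "'u itself"
  assumes universe: "universe_type U"
begin

lemma infinite_universe: "infinite (UNIV :: 'u set)"
  using universe by (simp add: universe_type_def)

lemma usmall_finite: "finite A \<Longrightarrow> usmall U A"
  unfolding usmall_def using infinite_universe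
  by (intro finite_ordLess_infinite)
    (auto simp: Field_card_of intro: card_of_Well_order card_of_well_order_on)

lemma small_finite: "finite A \<Longrightarrow> small (A :: 'u set)"
  using usmall_finite by (simp add: usmall_def small_def)

lemma stable_universe: "stable |UNIV :: 'u set|"
  using universe
  by (auto simp: universe_type_def Field_card_of intro!: regularCard_stable card_of_Card_order)

text \<open>Regularity of the cardinal enters here: an infinite regular cardinal is stable, so fewer
  than that many sets, each of smaller size, have a disjoint union of smaller size.\<close>

lemma usmall_Sigma: "usmall U A \<Longrightarrow> (\<And>a. a \<in> A \<Longrightarrow> usmall U (F a)) \<Longrightarrow> usmall U (Sigma A F)"
  unfolding usmall_def using stable_elim[OF stable_universe] by blast

lemma usmall_Un: "usmall U A \<Longrightarrow> usmall U B \<Longrightarrow> usmall U (A \<union> B)"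
  unfolding usmall_def using infinite_universe card_of_Un_ordLess_infinite by blast

text \<open>The strong limit hypothesis speaks of subsets of \<open>'u\<close>, so \<open>A\<close>
  is copied into \<open>'u\<close> and the bound for the power set of the copy is pulled back along
  the image map.\<close>

lemma usmall_Pow:
  assumes "usmall U A"
  shows "usmall U (Pow A)"
proof -
  obtain f :: "'a \<Rightarrow> 'u" where f: "inj_on f A"
    using assms usmall_embed[of A] by (auto simp: usmall_def)
  have "small (f ` A)"
    using usmall_image[OF assms, of f] by (simp add: small_def usmall_def)
  then have "usmall U (Pow (f ` A))"
    using universe by (auto simp: universe_type_def usmall_def)
  then have "usmall U (inv_into (Pow A) (image f) ` Pow (f ` A))"
    by (rule usmall_image)
  moreover have "inv_into (Pow A) (image f) ` Pow (f ` A) = Pow A"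
    by (metis bij_betw_def bij_betw_imp_surj_on bij_betw_inv_into f image_Pow_surj inj_on_image_Pow)
  ultimately show ?thesis by simp
qed

text \<open>A function on \<open>I\<close> is stored as its graph, a subset of
  \<open>Sigma I F\<close>; closure under sums and power sets bounds the number of graphs.
  Extensionality outside \<open>I\<close> makes the encoding injective.\<close>

lemma usmall_PiE:
  assumes "usmall U I" "\<And>i. i \<in> I \<Longrightarrow> usmall U (F i)"
  shows "usmall U (Pi\<^sub>E I F)"
proof -
  define gr where "gr f = (\<lambda>i. (i, f i)) ` I" for f :: "'a \<Rightarrow> 'b"
  have "gr ` Pi\<^sub>E I F \<subseteq> Pow (Sigma I F)"
    by (auto simp: gr_def)
  then have "usmall U (gr ` Pi\<^sub>E I F)"
    by (rule usmall_subset[OF usmall_Pow[OF usmall_Sigma[OF assms]], rotated])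
  then have "usmall U (inv_into (Pi\<^sub>E I F) gr ` gr ` Pi\<^sub>E I F)"
    by (rule usmall_image)
  moreover have "inj_on gr (Pi\<^sub>E I F)"
  proof (rule inj_onI)
    fix f g assume fg: "f \<in> Pi\<^sub>E I F" "g \<in> Pi\<^sub>E I F" "gr f = gr g"
    show "f = g"
    proof (rule PiE_ext[OF fg(1,2)])
      fix i assume "i \<in> I"
      then have "(i, f i) \<in> gr f" by (simp add: gr_def)
      then have "(i, f i) \<in> gr g" by (simp only: fg(3))
      then show "f i = g i" by (auto simp: gr_def)
    qed
  qed
  ultimately show ?thesis by (simp add: inv_into_image_cancel)
qed

text \<open>Graphs made of families, classes or sets enter \<open>'u\<close> here. Callers see only
  that the two labellings are bijective and compatible with ends, never how the labels were
  chosen.\<close>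

lemma hypergraph_of_types:
  fixes V :: "'v set" and E :: "'e set"
  assumes "usmall U V" "usmall U E" "\<And>e. e \<in> E \<Longrightarrow> en e \<subseteq> V"
  obtains G :: "'u hypergraph" and iv :: "'v \<Rightarrow> 'u" and ie :: "'e \<Rightarrow> 'u"
  where "hypergraph G" "bij_betw iv V (verts G)" "bij_betw ie E (edges G)"
    "\<And>e. e \<in> E \<Longrightarrow> ends G (ie e) = iv ` en e"
proof -
  obtain iv :: "'v \<Rightarrow> 'u" where iv: "inj_on iv V"
    using assms(1) usmall_embed[of V] by (auto simp: usmall_def)
  obtain ie :: "'e \<Rightarrow> 'u" where ie: "inj_on ie E"
    using assms(2) usmall_embed[of E] by (auto simp: usmall_def)
  define G where "G = \<lparr>verts = iv ` V, edges = ie ` E,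
    ends = (\<lambda>e\<in>ie ` E. iv ` en (inv_into E ie e))\<rparr>"
  have "hypergraph G"
    using usmall_image[OF assms(1), of iv] usmall_image[OF assms(2), of ie] assms(3) ie
    by (fastforce simp: hypergraph_def G_def small_def usmall_def)
  moreover have "bij_betw iv V (verts G)" "bij_betw ie E (edges G)"
    using iv ie by (auto simp: G_def bij_betw_def)
  moreover have "ends G (ie e) = iv ` en e" if "e \<in> E" for e
    using that ie by (simp add: G_def)
  ultimately show ?thesis by (rule that)
qed

end

section \<open>Morphisms of hypergraphs\<close>

lemma Ob_Hyp [simp]: "X \<in> Ob Hyp \<longleftrightarrow> hypergraph X"
  by (simp add: Hyp_def)

lemma Ob_Mult [simp]: "X \<in> Ob Mult \<longleftrightarrow> multigraph X"
  by (auto simp: Mult_def full_subcategory_def Hyp_def multigraph_def)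

lemma Dom_Hyp [simp]: "Dom Hyp = src" and Cod_Hyp [simp]: "Cod Hyp = tgt"
  and Dom_Mult [simp]: "Dom Mult = src" and Cod_Mult [simp]: "Cod Mult = tgt"
  and Comp_Mult [simp]: "Comp Mult = Comp Hyp" and Id_Mult [simp]: "Id Mult = Id Hyp"
  by (simp_all add: Mult_def full_subcategory_def Hyp_def)

lemma Arr_Hyp [simp]: "f \<in> Arr Hyp \<longleftrightarrow> hmorphism f"
  by (simp add: Hyp_def)

lemma Arr_Mult: "f \<in> Arr Mult \<longleftrightarrow> hmorphism f \<and> multigraph (src f) \<and> multigraph (tgt f)"
  by (auto simp: Mult_def full_subcategory_def Hyp_def)

lemma comp_src_tgt [simp]:
  "src (g \<cdot>\<^bsub>Hyp\<^esub> f) = src f" "tgt (g \<cdot>\<^bsub>Hyp\<^esub> f) = tgt g"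
  by (simp_all add: Hyp_def)

lemma comp_maps:
  "vmap (g \<cdot>\<^bsub>Hyp\<^esub> f) = compose (verts (src f)) (vmap g) (vmap f)"
  "emap (g \<cdot>\<^bsub>Hyp\<^esub> f) = compose (edges (src f)) (emap g) (emap f)"
  by (simp_all add: Hyp_def)

lemma Id_simps [simp]:
  "src (Id Hyp G) = G" "tgt (Id Hyp G) = G"
  "vmap (Id Hyp G) = (\<lambda>v\<in>verts G. v)" "emap (Id Hyp G) = (\<lambda>e\<in>edges G. e)"
  by (simp_all add: Hyp_def)

lemma Hom_Hyp: "f \<in> Hom Hyp X Y \<longleftrightarrow> hmorphism f \<and> src f = X \<and> tgt f = Y"
  by (auto simp: Hom_def Hyp_def)

lemma Hom_Mult: "f \<in> Hom Mult X Y \<longleftrightarrow> f \<in> Hom Hyp X Y \<and> multigraph X \<and> multigraph Y"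
  by (auto simp: Hom_Hyp Hom_def Arr_Mult)

lemma Hom_Mult_Hyp: "f \<in> Hom Mult X Y \<Longrightarrow> f \<in> Hom Hyp X Y"
  by (simp add: Hom_Mult)

lemma Arr_Mult_Hom: "f \<in> Arr Mult \<longleftrightarrow> f \<in> Hom Mult (src f) (tgt f)"
  by (auto simp: Arr_Mult Hom_Mult Hom_Hyp)

lemma multigraph_hypergraph: "multigraph G \<Longrightarrow> hypergraph G"
  by (simp add: multigraph_def)

lemma ends_subset: "hypergraph G \<Longrightarrow> e \<in> edges G \<Longrightarrow> ends G e \<subseteq> verts G"
  by (auto simp: hypergraph_def)

text \<open>Allowing \<open>a = b\<close> treats loops and links alike and supplies the ordering of
  ends that maps out of \<open>edge_graph\<close> need.\<close>

lemma multi_edge_iff: "multi_edge A \<longleftrightarrow> (\<exists>a b. A = {a, b})"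
proof
  assume "multi_edge A"
  then have "card A = 1 \<or> card A = 2" by (auto simp: multi_edge_def)
  then show "\<exists>a b. A = {a, b}" by (auto simp: card_1_singleton_iff card_2_iff)
qed (auto simp: multi_edge_def card_insert_if)

lemma multigraph_edgeE:
  assumes "multigraph G" "e \<in> edges G"
  obtains a b where "a \<in> verts G" "b \<in> verts G" "ends G e = {a, b}"
proof -
  obtain a b where "ends G e = {a, b}"
    using assms by (auto simp: multigraph_def multi_edge_iff)
  with ends_subset[of G e] that show ?thesis
    using assms by (auto simp: multigraph_def)
qed

context
  fixes f :: "'u hmor" and X Y
  assumes f: "f \<in> Hom Hyp X Y"
begin

lemma Hom_srctgt: "src f = X" "tgt f = Y" "hypergraph X" "hypergraph Y"
  using f by (auto simp: Hom_Hyp hmorphism_def)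

lemma vmap_in: "v \<in> verts X \<Longrightarrow> vmap f v \<in> verts Y"
  using f by (auto simp: Hom_Hyp hmorphism_def)

lemma emap_in: "e \<in> edges X \<Longrightarrow> emap f e \<in> edges Y"
  using f by (auto simp: Hom_Hyp hmorphism_def)

lemma ends_emap: "e \<in> edges X \<Longrightarrow> ends Y (emap f e) = vmap f ` ends X e"
  using f by (auto simp: Hom_Hyp hmorphism_def)

lemma vmap_comp: "v \<in> verts X \<Longrightarrow> vmap (g \<cdot>\<^bsub>Hyp\<^esub> f) v = vmap g (vmap f v)"
  using f by (auto simp: Hom_Hyp comp_maps compose_def)

lemma emap_comp: "e \<in> edges X \<Longrightarrow> emap (g \<cdot>\<^bsub>Hyp\<^esub> f) e = emap g (emap f e)"
  using f by (auto simp: Hom_Hyp comp_maps compose_def)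

end

lemma hmor_eqI:
  assumes f: "f \<in> Hom Hyp X Y" and g: "g \<in> Hom Hyp X Y"
    and "\<And>v. v \<in> verts X \<Longrightarrow> vmap f v = vmap g v"
    and "\<And>e. e \<in> edges X \<Longrightarrow> emap f e = emap g e"
  shows "f = g"
proof (rule hmor.equality)
  show "vmap f = vmap g"
    using assms by (intro PiE_ext[of _ "verts X" "\<lambda>_. verts Y"]) (auto simp: Hom_Hyp hmorphism_def)
  show "emap f = emap g"
    using assms by (intro PiE_ext[of _ "edges X" "\<lambda>_. edges Y"]) (auto simp: Hom_Hyp hmorphism_def)
qed (use f g in \<open>auto simp: Hom_Hyp\<close>)

lemma comp_Hyp: "f \<in> Hom Hyp X Y \<Longrightarrow> g \<in> Hom Hyp Y Z \<Longrightarrow> g \<cdot>\<^bsub>Hyp\<^esub> f \<in> Hom Hyp X Z"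
  by (rule category.Comp_Hom[OF category_Hyp])

lemma comp_Mult: "f \<in> Hom Mult X Y \<Longrightarrow> g \<in> Hom Mult Y Z \<Longrightarrow> g \<cdot>\<^bsub>Hyp\<^esub> f \<in> Hom Mult X Z"
  by (auto simp: Hom_Mult comp_Hyp)

lemma Id_Hyp: "hypergraph X \<Longrightarrow> Id Hyp X \<in> Hom Hyp X X"
  by (rule category.Id_Hom[OF category_Hyp]) simp

lemmas comp_assoc = category.Comp_assoc[OF category_Hyp]

lemma comp_eqD:
  assumes "g \<cdot>\<^bsub>Hyp\<^esub> f = k \<cdot>\<^bsub>Hyp\<^esub> h" "f \<in> Hom Hyp X Y" "h \<in> Hom Hyp X Z"
  shows "v \<in> verts X \<Longrightarrow> vmap g (vmap f v) = vmap k (vmap h v)"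
    and "e \<in> edges X \<Longrightarrow> emap g (emap f e) = emap k (emap h e)"
  using assms vmap_comp emap_comp by metis+

lemma comp_eqI:
  assumes "f \<in> Hom Hyp X Y" "g \<in> Hom Hyp Y Z" "h \<in> Hom Hyp X Z"
    and "\<And>v. v \<in> verts X \<Longrightarrow> vmap g (vmap f v) = vmap h v"
    and "\<And>e. e \<in> edges X \<Longrightarrow> emap g (emap f e) = emap h e"
  shows "g \<cdot>\<^bsub>Hyp\<^esub> f = h"
  using assms by (intro hmor_eqI[OF comp_Hyp]) (auto simp: vmap_comp emap_comp)

text \<open>Restriction makes both maps extensional, so a morphism is specified by its values on the
  carriers.\<close>

definition hmor_of :: "'u hypergraph \<Rightarrow> 'u hypergraph \<Rightarrow> ('u \<Rightarrow> 'u) \<Rightarrow> ('u \<Rightarrow> 'u) \<Rightarrow> 'u hmor" where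
  "hmor_of X Y fv fe =
     \<lparr>src = X, tgt = Y, vmap = restrict fv (verts X), emap = restrict fe (edges X)\<rparr>"

lemma hmor_of_simps [simp]:
  "src (hmor_of X Y fv fe) = X" "tgt (hmor_of X Y fv fe) = Y"
  "v \<in> verts X \<Longrightarrow> vmap (hmor_of X Y fv fe) v = fv v"
  "e \<in> edges X \<Longrightarrow> emap (hmor_of X Y fv fe) e = fe e"
  by (simp_all add: hmor_of_def)

lemma hmor_of_Hyp:
  assumes "hypergraph X" "hypergraph Y"
    and "\<And>v. v \<in> verts X \<Longrightarrow> fv v \<in> verts Y" "\<And>e. e \<in> edges X \<Longrightarrow> fe e \<in> edges Y"
    and "\<And>e. e \<in> edges X \<Longrightarrow> ends Y (fe e) = fv ` ends X e"
  shows "hmor_of X Y fv fe \<in> Hom Hyp X Y"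
proof -
  have "restrict fv (verts X) ` ends X e = fv ` ends X e" if "e \<in> edges X" for e
    using ends_subset[OF assms(1) that] by (intro image_cong) auto
  then show ?thesis using assms by (auto simp: Hom_Hyp hmorphism_def hmor_of_def)
qed

lemma hmor_of_Mult:
  assumes "multigraph X" "multigraph Y"
    and "\<And>v. v \<in> verts X \<Longrightarrow> fv v \<in> verts Y" "\<And>e. e \<in> edges X \<Longrightarrow> fe e \<in> edges Y"
    and "\<And>e. e \<in> edges X \<Longrightarrow> ends Y (fe e) = fv ` ends X e"
  shows "hmor_of X Y fv fe \<in> Hom Mult X Y"
  using assms by (simp add: Hom_Mult hmor_of_Hyp multigraph_hypergraph)

section \<open>Probes: the point and the edge\<close>

definition point_graph :: "'u \<Rightarrow> 'u hypergraph" where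
  "point_graph x = \<lparr>verts = {x}, edges = {}, ends = (\<lambda>_. undefined)\<rparr>"

text \<open>Vertices and edges are separate carriers, so \<open>x\<close> can also name the edge.
  For \<open>x = y\<close> the graph is a single loop, the terminal multigraph.\<close>

definition edge_graph :: "'u \<Rightarrow> 'u \<Rightarrow> 'u hypergraph" where
  "edge_graph x y = \<lparr>verts = {x, y}, edges = {x}, ends = (\<lambda>e\<in>{x}. {x, y})\<rparr>"

lemma point_graph_simps [simp]: "verts (point_graph x) = {x}" "edges (point_graph x) = {}"
  by (simp_all add: point_graph_def)

lemma edge_graph_simps [simp]:
  "verts (edge_graph x y) = {x, y}" "edges (edge_graph x y) = {x}" "ends (edge_graph x y) x = {x, y}"
  by (simp_all add: edge_graph_def)

definition point_map :: "'u \<Rightarrow> 'u hypergraph \<Rightarrow> 'u \<Rightarrow> 'u hmor" where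
  "point_map x G v = hmor_of (point_graph x) G (\<lambda>_. v) (\<lambda>_. undefined)"

definition edge_map :: "'u \<Rightarrow> 'u \<Rightarrow> 'u hypergraph \<Rightarrow> 'u \<Rightarrow> 'u \<Rightarrow> 'u \<Rightarrow> 'u hmor" where
  "edge_map x y G a b e = hmor_of (edge_graph x y) G (\<lambda>v. if v = x then a else b) (\<lambda>_. e)"

lemma point_map_simps [simp]: "vmap (point_map x G v) x = v"
  by (simp add: point_map_def)

lemma edge_map_simps [simp]:
  "vmap (edge_map x y G a b e) x = a" "x \<noteq> y \<Longrightarrow> vmap (edge_map x y G a b e) y = b"
  "emap (edge_map x y G a b e) x = e"
  by (simp_all add: edge_map_def)

context universe
begin

lemma multigraph_point_graph: "multigraph (point_graph x :: 'u hypergraph)"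
  by (auto simp: multigraph_def hypergraph_def point_graph_def small_finite)

lemma multigraph_edge_graph: "multigraph (edge_graph x y :: 'u hypergraph)"
  by (auto simp: multigraph_def hypergraph_def edge_graph_def small_finite multi_edge_iff)

lemma point_map_Hom: "multigraph G \<Longrightarrow> v \<in> verts G \<Longrightarrow> point_map x G (v :: 'u) \<in> Hom Mult (point_graph x) G"
  unfolding point_map_def by (rule hmor_of_Mult) (auto simp: multigraph_point_graph)

lemma edge_map_Hom:
  assumes "multigraph G" "e \<in> edges G" "ends G e = {a, b}" "(x :: 'u) \<noteq> y"
  shows "edge_map x y G a b e \<in> Hom Mult (edge_graph x y) G"
  using assms ends_subset[of G e] unfolding edge_map_def
  by (intro hmor_of_Mult) (auto simp: multigraph_edge_graph multigraph_hypergraph)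

lemma two_points: obtains x y :: 'u where "x \<noteq> y"
proof -
  have "UNIV \<noteq> {x}" for x :: 'u
    using infinite_universe by (metis finite.emptyI finite_insert)
  with that show ?thesis by (metis UNIV_eq_I singletonI)
qed

lemma monic_iff:
  "monic Mult (m :: 'u hmor) \<longleftrightarrow>
     m \<in> Arr Mult \<and> inj_on (vmap m) (verts (src m)) \<and> inj_on (emap m) (edges (src m))"
proof (intro iffI conjI)
  assume m: "monic Mult m"
  then show "m \<in> Arr Mult" by (simp add: monic_def)
  then have mH: "m \<in> Hom Hyp (src m) (tgt m)" and G: "multigraph (src m)"
    by (auto simp: Arr_Mult_Hom Hom_Mult)
  have cancel: "f = g" if "f \<in> Hom Mult X (src m)" "g \<in> Hom Mult X (src m)"
    "m \<cdot>\<^bsub>Hyp\<^esub> f = m \<cdot>\<^bsub>Hyp\<^esub> g" for f g X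
    using m that unfolding monic_def by (metis Comp_Mult Dom_Mult Hom_Mult Ob_Mult)
  obtain x y :: 'u where xy: "x \<noteq> y" by (rule two_points)
  show injv: "inj_on (vmap m) (verts (src m))"
  proof (rule inj_onI)
    fix v w assume vw: "v \<in> verts (src m)" "w \<in> verts (src m)" "vmap m v = vmap m w"
    note H = point_map_Hom[OF G vw(1), of x] point_map_Hom[OF G vw(2), of x]
    have "point_map x (src m) v = point_map x (src m) w"
    proof (rule cancel[OF H], rule hmor_eqI)
      show "m \<cdot>\<^bsub>Hyp\<^esub> point_map x (src m) v \<in> Hom Hyp (point_graph x) (tgt m)"
        "m \<cdot>\<^bsub>Hyp\<^esub> point_map x (src m) w \<in> Hom Hyp (point_graph x) (tgt m)"
        using H mH by (auto intro: comp_Hyp Hom_Mult_Hyp)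
    qed (use H[THEN Hom_Mult_Hyp] vw in \<open>auto simp: vmap_comp\<close>)
    then show "v = w" by (metis point_map_simps)
  qed
  show "inj_on (emap m) (edges (src m))"
  proof (rule inj_onI)
    fix d e assume de: "d \<in> edges (src m)" "e \<in> edges (src m)" "emap m d = emap m e"
    have "vmap m ` ends (src m) d = vmap m ` ends (src m) e"
      using de ends_emap[OF mH] by metis
    then have "ends (src m) d = ends (src m) e"
      using inj_on_image_eq_iff[OF injv] ends_subset[OF multigraph_hypergraph[OF G]] de by metis
    \<comment> \<open>Both edges are probed with the same ordering of the same ends, so the probes
      can differ only on the edge and become equal after \<open>m\<close>. That the ends agree rests
      on injectivity on vertices, established just before.\<close>
    then obtain a b where ab: "ends (src m) d = {a, b}" "ends (src m) e = {a, b}"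
      using multigraph_edgeE[OF G de(1)] by metis
    note H = edge_map_Hom[OF G de(1) ab(1) xy] edge_map_Hom[OF G de(2) ab(2) xy]
    have "edge_map x y (src m) a b d = edge_map x y (src m) a b e"
    proof (rule cancel[OF H], rule hmor_eqI)
      show "m \<cdot>\<^bsub>Hyp\<^esub> edge_map x y (src m) a b d \<in> Hom Hyp (edge_graph x y) (tgt m)"
        "m \<cdot>\<^bsub>Hyp\<^esub> edge_map x y (src m) a b e \<in> Hom Hyp (edge_graph x y) (tgt m)"
        using H mH by (auto intro: comp_Hyp Hom_Mult_Hyp)
    qed (use H[THEN Hom_Mult_Hyp] de xy in \<open>auto simp: vmap_comp emap_comp\<close>)
    then show "d = e" by (metis edge_map_simps(3))
  qed
next
  assume m: "m \<in> Arr Mult \<and> inj_on (vmap m) (verts (src m)) \<and> inj_on (emap m) (edges (src m))"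
  show "monic Mult m"
    unfolding monic_def Dom_Mult Comp_Mult
  proof (intro conjI ballI impI)
    show "m \<in> Arr Mult" using m by simp
  next
    fix X f g assume H: "f \<in> Hom Mult X (src m)" "g \<in> Hom Mult X (src m)"
      and eq: "m \<cdot>\<^bsub>Hyp\<^esub> f = m \<cdot>\<^bsub>Hyp\<^esub> g"
    note H' = H[THEN Hom_Mult_Hyp]
    show "f = g"
      using m H' comp_eqD[OF eq H'] by (intro hmor_eqI[OF H']) (auto simp: inj_on_def vmap_in emap_in)
  qed
qed

lemma pullback_vertex:
  assumes pb: "is_pullback Mult f g p q" and vw: "(v :: 'u) \<in> verts (src f)" "w \<in> verts (src g)"
    "vmap f v = vmap g w"
  obtains k where "k \<in> verts (src p)" "vmap p k = v" "vmap q k = w"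
proof -
  note [simp] = vw(3)
  have fg: "f \<in> Hom Mult (src f) (tgt f)" "g \<in> Hom Mult (src g) (tgt f)"
    using pb by (auto simp: is_pullback_def Arr_Mult_Hom)
  then have G: "multigraph (src f)" "multigraph (src g)"
    by (auto simp: Hom_Mult)
  \<comment> \<open>Any element of the type can name the vertex of the probe.\<close>
  fix x :: 'u
  note H = point_map_Hom[OF G(1) vw(1), of x] point_map_Hom[OF G(2) vw(2), of x]
  have "f \<cdot>\<^bsub>Hyp\<^esub> point_map x (src f) v = g \<cdot>\<^bsub>Hyp\<^esub> point_map x (src g) w"
    using comp_Mult[OF H(1) fg(1)] comp_Mult[OF H(2) fg(2)] H[THEN Hom_Mult_Hyp]
    by (intro hmor_eqI[OF Hom_Mult_Hyp Hom_Mult_Hyp]) (auto simp: vmap_comp)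
  then obtain u where u: "u \<in> Hom Mult (point_graph x) (src p)"
    "p \<cdot>\<^bsub>Hyp\<^esub> u = point_map x (src f) v" "q \<cdot>\<^bsub>Hyp\<^esub> u = point_map x (src g) w"
    using pb H multigraph_point_graph[of x] unfolding is_pullback_def
    by (metis Comp_Mult Dom_Mult Ob_Mult)
  note uH = Hom_Mult_Hyp[OF u(1)]
  show ?thesis
    using that[of "vmap u x"] vmap_in[OF uH] vmap_comp[OF uH, of x p] vmap_comp[OF uH, of x q] u(2,3)
    by simp
qed

text \<open>Only existence is claimed: several edges of the pullback can lie over one pair, such as
  diagonal and antidiagonal when the common target is a loop.\<close>

lemma pullback_edge:
  assumes pb: "is_pullback Mult f g p q" and e: "(e :: 'u) \<in> edges (src f)" "d \<in> edges (src g)"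
    "emap f e = emap g d"
  obtains k where "k \<in> edges (src p)" "emap p k = e" "emap q k = d"
proof -
  have fg: "f \<in> Hom Mult (src f) (tgt f)" "g \<in> Hom Mult (src g) (tgt f)"
    using pb by (auto simp: is_pullback_def Arr_Mult_Hom)
  then have G: "multigraph (src f)" "multigraph (src g)"
    by (auto simp: Hom_Mult)
  obtain a b where ab: "ends (src f) e = {a, b}"
    using multigraph_edgeE[OF G(1) e(1)] by metis
  obtain a0 b0 where ab0: "ends (src g) d = {a0, b0}"
    using multigraph_edgeE[OF G(2) e(2)] by metis
  have "{vmap f a, vmap f b} = {vmap g a0, vmap g b0}"
    using e(3) ends_emap[OF Hom_Mult_Hyp[OF fg(1)] e(1)] ends_emap[OF Hom_Mult_Hyp[OF fg(2)] e(2)]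
    by (simp add: ab ab0)
  \<comment> \<open>Equal unordered pairs agree after at most one swap, so the ends of
    \<open>d\<close> can be listed in an order whose images match those of \<open>a\<close> and
    \<open>b\<close>. This makes the two probes agree over the common target.\<close>
  then obtain a' b' where ab': "ends (src g) d = {a', b'}" "vmap f a = vmap g a'" "vmap f b = vmap g b'"
    using ab0 by (metis doubleton_eq_iff)
  obtain x y :: 'u where xy: "x \<noteq> y" by (rule two_points)
  note H = edge_map_Hom[OF G(1) e(1) ab xy] edge_map_Hom[OF G(2) e(2) ab'(1) xy]
  have "f \<cdot>\<^bsub>Hyp\<^esub> edge_map x y (src f) a b e = g \<cdot>\<^bsub>Hyp\<^esub> edge_map x y (src g) a' b' d"
    using comp_Mult[OF H(1) fg(1)] comp_Mult[OF H(2) fg(2)] H[THEN Hom_Mult_Hyp] ab' xy e(3)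
    by (intro hmor_eqI[OF Hom_Mult_Hyp Hom_Mult_Hyp]) (auto simp: vmap_comp emap_comp)
  then obtain u where u: "u \<in> Hom Mult (edge_graph x y) (src p)"
    "p \<cdot>\<^bsub>Hyp\<^esub> u = edge_map x y (src f) a b e" "q \<cdot>\<^bsub>Hyp\<^esub> u = edge_map x y (src g) a' b' d"
    using pb H multigraph_edge_graph[of x y] unfolding is_pullback_def
    by (metis Comp_Mult Dom_Mult Ob_Mult)
  note uH = Hom_Mult_Hyp[OF u(1)]
  show ?thesis
    using that[of "emap u x"] emap_in[OF uH] emap_comp[OF uH, of x p] emap_comp[OF uH, of x q] u(2,3)
    by simp
qed

end

section \<open>Limits and colimits of multigraphs\<close>

text \<open>This asks for exactly what cones and cocones refer to. Shapes that are mere graphs, such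
  as a parallel pair or a cospan without identities, are thereby covered.\<close>

definition is_diagram :: "('i, 'j) cat \<Rightarrow> ('o, 'm) cat \<Rightarrow> ('i, 'j, 'o, 'm) func \<Rightarrow> bool" where
  "is_diagram J C D \<longleftrightarrow> (\<forall>i\<in>Ob J. FO D i \<in> Ob C) \<and>
     (\<forall>a\<in>Arr J. Dom J a \<in> Ob J \<and> Cod J a \<in> Ob J \<and>
        FA D a \<in> Hom C (FO D (Dom J a)) (FO D (Cod J a)))"

lemma is_functor_diagram: "is_functor J C D \<Longrightarrow> is_diagram J C D"
  by (auto simp: is_functor_def is_diagram_def Hom_def category_def)

context universe
begin

theorem Mult_limit:
  fixes J :: "('i, 'j) cat" and D :: "('i, 'j, 'u hypergraph, 'u hmor) func"
  assumes D: "is_diagram J Mult D" and J: "usmall U (Ob J)"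
  obtains X t where "is_limit J Mult D X t"
proof -
  have Dob: "multigraph (FO D i)" if "i \<in> Ob J" for i
    using D that by (simp add: is_diagram_def)
  have Darr: "Dom J a \<in> Ob J" "Cod J a \<in> Ob J" "FA D a \<in> Hom Hyp (FO D (Dom J a)) (FO D (Cod J a))"
    if "a \<in> Arr J" for a
    using D that by (auto simp: is_diagram_def Hom_Mult)
  define V where "V = {x \<in> \<Pi>\<^sub>E i\<in>Ob J. verts (FO D i).
    \<forall>a\<in>Arr J. vmap (FA D a) (x (Dom J a)) = x (Cod J a)}"
  define L where "L = {y \<in> \<Pi>\<^sub>E i\<in>Ob J. edges (FO D i).
    \<forall>a\<in>Arr J. emap (FA D a) (y (Dom J a)) = y (Cod J a)}"
  \<comment> \<open>The set \<open>S\<close> is recorded because \<open>y\<close> need not determine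
    it. Its members are compatible families already, so \<open>S\<close> respects all arrows. For an
    empty shape there is one family of each kind and one \<open>S\<close>, which gives a
    loop.\<close>
  define E where "E = {(y, S). y \<in> L \<and> S \<subseteq> V \<and> multi_edge S \<and>
    (\<forall>i\<in>Ob J. ends (FO D i) (y i) = (\<lambda>x. x i) ` S)}"
  have small: "usmall U (verts (FO D i))" "usmall U (edges (FO D i))" if "i \<in> Ob J" for i
    using Dob[OF that] by (auto simp: multigraph_def hypergraph_def small_def usmall_def)
  have sV: "usmall U V"
    by (rule usmall_subset[OF usmall_PiE[OF J small(1)]]) (auto simp: V_def)
  have "usmall U L"
    by (rule usmall_subset[OF usmall_PiE[OF J small(2)]]) (auto simp: L_def)
  then have sE: "usmall U E"
    by (rule usmall_subset[OF usmall_Sigma[OF _ usmall_Pow[OF sV]]]) (auto simp: E_def)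
  obtain G and iv :: "('i \<Rightarrow> 'u) \<Rightarrow> 'u" and ie :: "('i \<Rightarrow> 'u) \<times> ('i \<Rightarrow> 'u) set \<Rightarrow> 'u"
    where G: "hypergraph G" "bij_betw iv V (verts G)" "bij_betw ie E (edges G)"
      and ends: "\<And>e. e \<in> E \<Longrightarrow> ends G (ie e) = iv ` snd e"
    by (rule hypergraph_of_types[OF sV sE, of snd]) (auto simp: E_def)
  have inv_iv: "inv_into V iv (iv x) = x" if "x \<in> V" for x
    using G(2) that by (simp add: bij_betw_def)
  have inv_ie: "inv_into E ie (ie e) = e" if "e \<in> E" for e
    using G(3) that by (simp add: bij_betw_def)
  have verts: "verts G = iv ` V" and edges: "edges G = ie ` E"
    using G by (auto simp: bij_betw_def)
  have mG: "multigraph G"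
    using G(1) by (auto simp: multigraph_def edges ends) (auto simp: E_def multi_edge_image)
  define t where "t i = hmor_of G (FO D i) (\<lambda>v. inv_into V iv v i) (\<lambda>e. fst (inv_into E ie e) i)" for i
  have tv: "vmap (t i) (iv x) = x i" if "x \<in> V" for i x
    using that by (simp add: t_def verts inv_iv)
  have te: "emap (t i) (ie e) = fst e i" if "e \<in> E" for i e
    using that by (simp add: t_def edges inv_ie)
  have tH: "t i \<in> Hom Mult G (FO D i)" if i: "i \<in> Ob J" for i
    unfolding t_def
  proof (rule hmor_of_Mult[OF mG Dob[OF i]])
    show "inv_into V iv v i \<in> verts (FO D i)" if "v \<in> verts G" for v
      using that i by (auto simp: verts inv_iv) (auto simp: V_def)
    show "fst (inv_into E ie e) i \<in> edges (FO D i)" if "e \<in> edges G" for e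
      using that i by (auto simp: edges inv_ie) (auto simp: E_def L_def)
    show "ends (FO D i) (fst (inv_into E ie e) i) = (\<lambda>v. inv_into V iv v i) ` ends G e"
      if e: "e \<in> edges G" for e
    proof -
      obtain d where d: "d \<in> E" "e = ie d" using e by (auto simp: edges)
      then have "ends (FO D i) (fst d i) = (\<lambda>x. x i) ` snd d" "snd d \<subseteq> V"
        using i by (auto simp: E_def)
      moreover have "(\<lambda>v. inv_into V iv v i) ` iv ` snd d = (\<lambda>x. x i) ` snd d"
        unfolding image_image using \<open>snd d \<subseteq> V\<close> by (intro image_cong) (auto simp: inv_iv)
      ultimately show ?thesis using d by (simp add: inv_ie ends)
    qed
  qed
  have "is_limit J Mult D G t"
    unfolding is_limit_def is_cone_def Comp_Mult
  proof (intro conjI ballI allI impI)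
    show "G \<in> Ob Mult" using mG by simp
  next
    fix i assume "i \<in> Ob J" then show "t i \<in> Hom Mult G (FO D i)" by (rule tH)
  next
    fix a assume a: "a \<in> Arr J"
    show "FA D a \<cdot>\<^bsub>Hyp\<^esub> t (Dom J a) = t (Cod J a)"
    proof (rule comp_eqI)
      show "t (Dom J a) \<in> Hom Hyp G (FO D (Dom J a))" "t (Cod J a) \<in> Hom Hyp G (FO D (Cod J a))"
        "FA D a \<in> Hom Hyp (FO D (Dom J a)) (FO D (Cod J a))"
        using tH Darr a by (auto simp: Hom_Mult)
    next
      fix v assume "v \<in> verts G"
      then show "vmap (FA D a) (vmap (t (Dom J a)) v) = vmap (t (Cod J a)) v"
        using a by (auto simp: verts tv) (auto simp: V_def)
    next
      fix e assume "e \<in> edges G"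
      then show "emap (FA D a) (emap (t (Dom J a)) e) = emap (t (Cod J a)) e"
        using a by (auto simp: edges te) (auto simp: E_def L_def)
    qed
  next
    fix Y s
    assume s: "Y \<in> Ob Mult \<and> (\<forall>i\<in>Ob J. s i \<in> Hom Mult Y (FO D i)) \<and>
      (\<forall>a\<in>Arr J. FA D a \<cdot>\<^bsub>Hyp\<^esub> s (Dom J a) = s (Cod J a))"
    then have mY: "multigraph Y" and sH: "\<And>i. i \<in> Ob J \<Longrightarrow> s i \<in> Hom Hyp Y (FO D i)"
      by (auto simp: Hom_Mult)
    define hv where "hv v = (\<lambda>i\<in>Ob J. vmap (s i) v)" for v
    \<comment> \<open>A morphism sends ends to ends, so the second component is forced to be the
      image of the ends of \<open>e\<close>.\<close>
    define he where "he e = (\<lambda>i\<in>Ob J. emap (s i) e, hv ` ends Y e)" for e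
    have nat: "vmap (FA D a) (vmap (s (Dom J a)) v) = vmap (s (Cod J a)) v"
      if "a \<in> Arr J" "v \<in> verts Y" for a v
      using vmap_comp[OF sH that(2)] s that Darr[OF that(1)] by metis
    have nate: "emap (FA D a) (emap (s (Dom J a)) e) = emap (s (Cod J a)) e"
      if "a \<in> Arr J" "e \<in> edges Y" for a e
      using emap_comp[OF sH that(2)] s that Darr[OF that(1)] by metis
    have hv: "hv v \<in> V" if "v \<in> verts Y" for v
      using that by (auto simp: hv_def V_def Darr nat vmap_in[OF sH])
    have subY: "ends Y e \<subseteq> verts Y" if "e \<in> edges Y" for e
      using ends_subset[OF multigraph_hypergraph[OF mY] that] .
    have he: "he e \<in> E" if e: "e \<in> edges Y" for e
    proof -
      have "(\<lambda>x. x i) ` hv ` ends Y e = ends (FO D i) (emap (s i) e)" if "i \<in> Ob J" for i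
        using that ends_emap[OF sH[OF that] e] by (simp add: image_image hv_def)
      moreover have "hv ` ends Y e \<subseteq> V" using subY[OF e] hv by auto
      moreover have "multi_edge (hv ` ends Y e)"
        using mY e by (auto simp: multigraph_def multi_edge_image)
      ultimately show ?thesis
        using e by (auto simp: he_def E_def L_def Darr nate emap_in[OF sH])
    qed
    define u where "u = hmor_of Y G (\<lambda>v. iv (hv v)) (\<lambda>e. ie (he e))"
    have uH: "u \<in> Hom Mult Y G"
      unfolding u_def using mY mG hv he
      by (intro hmor_of_Mult) (auto simp: verts edges ends he_def image_image)
    have uv: "vmap u v = iv (hv v)" if "v \<in> verts Y" for v
      using that by (simp add: u_def)
    have ue: "emap u e = ie (he e)" if "e \<in> edges Y" for e
      using that by (simp add: u_def)
    show "\<exists>!u. u \<in> Hom Mult Y G \<and> (\<forall>i\<in>Ob J. t i \<cdot>\<^bsub>Hyp\<^esub> u = s i)"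
    proof (intro ex1I[of _ u] conjI ballI uH)
      fix i assume i: "i \<in> Ob J"
      show "t i \<cdot>\<^bsub>Hyp\<^esub> u = s i"
        by (rule comp_eqI[OF Hom_Mult_Hyp[OF uH] Hom_Mult_Hyp[OF tH[OF i]] sH[OF i]])
          (use i in \<open>auto simp: uv ue tv te hv he\<close>, auto simp: hv_def he_def)
    next
      fix w assume w: "w \<in> Hom Mult Y G \<and> (\<forall>i\<in>Ob J. t i \<cdot>\<^bsub>Hyp\<^esub> w = s i)"
      then have wH: "w \<in> Hom Hyp Y G" by (simp add: Hom_Mult)
      have wv: "vmap w v = iv (hv v)" if v: "v \<in> verts Y" for v
      proof -
        obtain x where x: "x \<in> V" "vmap w v = iv x"
          using vmap_in[OF wH v] by (auto simp: verts)
        have "x i = vmap (s i) v" if "i \<in> Ob J" for i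
          using w that vmap_comp[OF wH v, of "t i"] x by (simp add: tv)
        then have "x = hv v"
          using x(1) hv[OF v] by (intro PiE_ext[of x "Ob J" "\<lambda>i. verts (FO D i)"]) (auto simp: V_def hv_def)
        then show ?thesis using x by simp
      qed
      have we: "emap w e = ie (he e)" if e: "e \<in> edges Y" for e
      proof -
        obtain d where d: "d \<in> E" "emap w e = ie d"
          using emap_in[OF wH e] by (auto simp: edges)
        have "fst d i = emap (s i) e" if "i \<in> Ob J" for i
          using w that emap_comp[OF wH e, of "t i"] d by (simp add: te)
        then have "fst d = fst (he e)"
          using d(1) he[OF e]
          by (intro PiE_ext[of "fst d" "Ob J" "\<lambda>i. edges (FO D i)"]) (auto simp: E_def L_def he_def)
        \<comment> \<open>The projections see only the family of edges; the recorded set is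
          recovered from the ends of \<open>emap w e\<close>, since \<open>w\<close> is already
          known on vertices.\<close>
        moreover have "iv ` snd d = iv ` snd (he e)"
          using ends_emap[OF wH e] d subY[OF e]
          by (auto simp: ends he_def image_image wv intro!: image_cong)
        then have "snd d = snd (he e)"
          using G(2) d(1) he[OF e]
          by (subst (asm) inj_on_image_eq_iff[of iv V]) (auto simp: bij_betw_def E_def)
        ultimately have "d = he e" by (rule prod_eqI)
        then show ?thesis using d by simp
      qed
      show "w = u"
        by (rule hmor_eqI[OF wH Hom_Mult_Hyp[OF uH]]) (simp_all add: wv we uv ue)
    qed
  qed
  then show ?thesis by (rule that)
qed

end

section \<open>Quotients by generated equivalence relations, and colimits\<close>

definition glue :: "('a \<times> 'a) set \<Rightarrow> 'a \<Rightarrow> 'a set" where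
  "glue R p = {q. (p, q) \<in> (R \<union> R\<inverse>)\<^sup>*}"

lemma glue_refl: "p \<in> glue R p"
  by (simp add: glue_def)

lemma glue_respects:
  assumes "q \<in> glue R p" "\<And>a b. (a, b) \<in> R \<Longrightarrow> h a = h b"
  shows "h p = h q"
proof -
  have "(p, q) \<in> (R \<union> R\<inverse>)\<^sup>*" using assms(1) by (simp add: glue_def)
  then show ?thesis by induction (use assms(2) in auto)
qed

lemma glue_eqI: "(p, q) \<in> R \<Longrightarrow> glue R p = glue R q"
proof -
  assume "(p, q) \<in> R"
  then have "(p, q) \<in> (R \<union> R\<inverse>)\<^sup>*" "(q, p) \<in> (R \<union> R\<inverse>)\<^sup>*" by auto
  then show ?thesis unfolding glue_def by (auto intro: rtrancl_trans)
qed

text \<open>A map that is constant on generating pairs descends to classes: the universal property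
  of the quotient, in the form used for the mediating morphism.\<close>

lemma glue_eqD: "glue R p = glue R q \<Longrightarrow> (\<And>a b. (a, b) \<in> R \<Longrightarrow> h a = h b) \<Longrightarrow> h p = h q"
  using glue_respects[of q R p h] glue_refl[of q R] by simp

context universe
begin

theorem Mult_colimit:
  fixes J :: "('i, 'j) cat" and D :: "('i, 'j, 'u hypergraph, 'u hmor) func"
  assumes D: "is_diagram J Mult D" and J: "usmall U (Ob J)"
  obtains X t where "is_colimit J Mult D X t"
proof -
  have Dob: "multigraph (FO D i)" if "i \<in> Ob J" for i
    using D that by (simp add: is_diagram_def)
  have Darr: "Dom J a \<in> Ob J" "Cod J a \<in> Ob J" "FA D a \<in> Hom Hyp (FO D (Dom J a)) (FO D (Cod J a))"
    if "a \<in> Arr J" for a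
    using D that by (auto simp: is_diagram_def Hom_Mult)
  define VS where "VS = Sigma (Ob J) (\<lambda>i. verts (FO D i))"
  define ES where "ES = Sigma (Ob J) (\<lambda>i. edges (FO D i))"
  define RV where "RV = {((Dom J a, v), (Cod J a, vmap (FA D a) v)) | a v.
    a \<in> Arr J \<and> v \<in> verts (FO D (Dom J a))}"
  define RE where "RE = {((Dom J a, e), (Cod J a, emap (FA D a) e)) | a e.
    a \<in> Arr J \<and> e \<in> edges (FO D (Dom J a))}"
  \<comment> \<open>The ends of an edge of a summand, as classes of vertices. \<open>en\<close>
    evaluates \<open>k\<close> on a class of edges by a union: \<open>k\<close> turns out to be
    constant on each class, so the union is the common value and no representative is
    chosen.\<close>
  define k where "k = (\<lambda>(i, e). (\<lambda>v. glue RV (i, v)) ` ends (FO D i) e)"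
  define en where "en c = \<Union> (k ` c)" for c
  have small: "usmall U (verts (FO D i))" "usmall U (edges (FO D i))" if "i \<in> Ob J" for i
    using Dob[OF that] by (auto simp: multigraph_def hypergraph_def small_def usmall_def)
  have sV: "usmall U (glue RV ` VS)" and sE: "usmall U (glue RE ` ES)"
    unfolding VS_def ES_def using J small by (auto intro!: usmall_image usmall_Sigma)
  have sub: "ends (FO D i) e \<subseteq> verts (FO D i)" if "(i, e) \<in> ES" for i e
    using that by (auto simp: ES_def dest: ends_subset[OF multigraph_hypergraph[OF Dob]])
  have k: "k p = k q" if "(p, q) \<in> RE" for p q
  proof -
    obtain a e where a: "a \<in> Arr J" "e \<in> edges (FO D (Dom J a))"
      and pq: "p = (Dom J a, e)" "q = (Cod J a, emap (FA D a) e)"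
      using \<open>(p, q) \<in> RE\<close> by (auto simp: RE_def)
    \<comment> \<open>Moving an end along the arrow \<open>a\<close> stays within its class, so an
      edge and its image have the same classes of ends.\<close>
    have "glue RV (Dom J a, v) = glue RV (Cod J a, vmap (FA D a) v)"
      if "v \<in> ends (FO D (Dom J a)) e" for v
      using that a sub[of "Dom J a" e] Darr[OF a(1)] by (intro glue_eqI) (auto simp: RV_def ES_def)
    then show ?thesis
      using a Darr[OF a(1)] by (auto simp: k_def pq ends_emap image_image intro!: image_cong)
  qed
  have en: "en (glue RE p) = k p" for p
  proof -
    have "k q = k p" if "q \<in> glue RE p" for q
      using glue_respects[OF that, of k] k by simp
    then have "en (glue RE p) = (\<Union>q\<in>glue RE p. k p)"
      unfolding en_def by (rule SUP_cong[OF refl])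
    with glue_refl[of p RE] show ?thesis by auto
  qed
  have k_sub: "k p \<subseteq> glue RV ` VS" if "p \<in> ES" for p
    using that sub by (fastforce simp: k_def VS_def ES_def)
  have en_sub: "en c \<subseteq> glue RV ` VS" if "c \<in> glue RE ` ES" for c
    using that by (elim imageE) (simp add: en k_sub)
  obtain G and iv :: "('i \<times> 'u) set \<Rightarrow> 'u" and ie :: "('i \<times> 'u) set \<Rightarrow> 'u"
    where G: "hypergraph G" "bij_betw iv (glue RV ` VS) (verts G)" "bij_betw ie (glue RE ` ES) (edges G)"
      and ends: "\<And>c. c \<in> glue RE ` ES \<Longrightarrow> ends G (ie c) = iv ` en c"
    by (rule hypergraph_of_types[OF sV sE, of en]) (auto intro: en_sub[THEN subsetD])
  define cv where "cv p = iv (glue RV p)" for p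
  define ce where "ce p = ie (glue RE p)" for p
  have verts: "verts G = cv ` VS" and edges: "edges G = ce ` ES"
    using G by (auto simp: bij_betw_def cv_def ce_def)
  have cv_eqD: "h p = h q" if "cv p = cv q" "p \<in> VS" "q \<in> VS" "\<And>a b. (a, b) \<in> RV \<Longrightarrow> h a = h b"
    for h :: "'i \<times> 'u \<Rightarrow> 'u" and p q
  proof (rule glue_eqD[OF _ that(4)])
    show "glue RV p = glue RV q"
      using G(2) that(1-3) by (auto simp: bij_betw_def cv_def dest: inj_onD)
  qed
  have ce_eqD: "h p = h q" if "ce p = ce q" "p \<in> ES" "q \<in> ES" "\<And>a b. (a, b) \<in> RE \<Longrightarrow> h a = h b"
    for h :: "'i \<times> 'u \<Rightarrow> 'u" and p q
  proof (rule glue_eqD[OF _ that(4)])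
    show "glue RE p = glue RE q"
      using G(3) that(1-3) by (auto simp: bij_betw_def ce_def dest: inj_onD)
  qed
  have cv_R: "cv p = cv q" if "(p, q) \<in> RV" for p q
    using glue_eqI[OF that] by (simp add: cv_def)
  have ce_R: "ce p = ce q" if "(p, q) \<in> RE" for p q
    using glue_eqI[OF that] by (simp add: ce_def)
  have endsG: "ends G (ce (i, e)) = (\<lambda>v. cv (i, v)) ` ends (FO D i) e" if "(i, e) \<in> ES" for i e
    using that ends[of "glue RE (i, e)"] by (simp add: ce_def en k_def image_image cv_def)
  \<comment> \<open>The ends of a glued edge are the image of the ends of a representative, and such
    an image still has one or two elements.\<close>
  have mG: "multigraph G"
    using G(1) Dob by (auto simp: multigraph_def edges endsG ES_def intro!: multi_edge_image)
  define t where "t i = hmor_of (FO D i) G (\<lambda>v. cv (i, v)) (\<lambda>e. ce (i, e))" for i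
  have tH: "t i \<in> Hom Mult (FO D i) G" if "i \<in> Ob J" for i
    unfolding t_def using that mG Dob
    by (intro hmor_of_Mult) (auto simp: verts edges endsG VS_def ES_def)
  have "is_colimit J Mult D G t"
    unfolding is_colimit_def is_cocone_def Comp_Mult
  proof (intro conjI ballI allI impI)
    show "G \<in> Ob Mult" using mG by simp
  next
    fix i assume "i \<in> Ob J" then show "t i \<in> Hom Mult (FO D i) G" by (rule tH)
  next
    fix a assume a: "a \<in> Arr J"
    note aH = Darr[OF a]
    show "t (Cod J a) \<cdot>\<^bsub>Hyp\<^esub> FA D a = t (Dom J a)"
    proof (rule comp_eqI[OF aH(3) Hom_Mult_Hyp[OF tH[OF aH(2)]] Hom_Mult_Hyp[OF tH[OF aH(1)]]])
      fix v assume v: "v \<in> verts (FO D (Dom J a))"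
      then have "cv (Dom J a, v) = cv (Cod J a, vmap (FA D a) v)"
        using a by (intro cv_R) (auto simp: RV_def)
      then show "vmap (t (Cod J a)) (vmap (FA D a) v) = vmap (t (Dom J a)) v"
        using v vmap_in[OF aH(3) v] by (simp add: t_def)
    next
      fix e assume e: "e \<in> edges (FO D (Dom J a))"
      then have "ce (Dom J a, e) = ce (Cod J a, emap (FA D a) e)"
        using a by (intro ce_R) (auto simp: RE_def)
      then show "emap (t (Cod J a)) (emap (FA D a) e) = emap (t (Dom J a)) e"
        using e emap_in[OF aH(3) e] by (simp add: t_def)
    qed
  next
    fix Y s
    assume s: "Y \<in> Ob Mult \<and> (\<forall>i\<in>Ob J. s i \<in> Hom Mult (FO D i) Y) \<and>
      (\<forall>a\<in>Arr J. s (Cod J a) \<cdot>\<^bsub>Hyp\<^esub> FA D a = s (Dom J a))"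
    then have mY: "multigraph Y" and sH: "\<And>i. i \<in> Ob J \<Longrightarrow> s i \<in> Hom Hyp (FO D i) Y"
      by (auto simp: Hom_Mult)
    define hv where "hv = (\<lambda>(i, v). vmap (s i) v)"
    define he where "he = (\<lambda>(i, e). emap (s i) e)"
    have s_nat: "s (Cod J a) \<cdot>\<^bsub>Hyp\<^esub> FA D a = s (Dom J a)" if "a \<in> Arr J" for a
      using s that by simp
    have hv_R: "hv p = hv q" if "(p, q) \<in> RV" for p q
      using that vmap_comp[OF Darr(3), symmetric] by (auto simp: RV_def hv_def s_nat)
    have he_R: "he p = he q" if "(p, q) \<in> RE" for p q
      using that emap_comp[OF Darr(3), symmetric] by (auto simp: RE_def he_def s_nat)
    \<comment> \<open>The inverses pick arbitrary representatives; \<open>hv\<close> and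
      \<open>he\<close> are constant on classes, so the choice does not affect the values.\<close>
    define u where "u = hmor_of G Y (\<lambda>v. hv (inv_into VS cv v)) (\<lambda>e. he (inv_into ES ce e))"
    have hv_inv: "hv (inv_into VS cv (cv p)) = hv p" if "p \<in> VS" for p
      using that by (intro cv_eqD[OF _ _ _ hv_R]) (auto intro: inv_into_into f_inv_into_f)
    have he_inv: "he (inv_into ES ce (ce p)) = he p" if "p \<in> ES" for p
      using that by (intro ce_eqD[OF _ _ _ he_R]) (auto intro: inv_into_into f_inv_into_f)
    have uv: "vmap u (cv p) = hv p" if "p \<in> VS" for p
      using that by (simp add: u_def verts hv_inv)
    have ue: "emap u (ce p) = he p" if "p \<in> ES" for p
      using that by (simp add: u_def edges he_inv)
    have uH: "u \<in> Hom Mult G Y"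
      unfolding u_def
    proof (rule hmor_of_Mult[OF mG mY])
      fix v assume "v \<in> verts G"
      then show "hv (inv_into VS cv v) \<in> verts Y"
        using vmap_in[OF sH] by (auto simp: verts hv_inv) (auto simp: VS_def hv_def)
    next
      fix e assume "e \<in> edges G"
      then obtain i d where d: "(i, d) \<in> ES" "e = ce (i, d)" by (auto simp: edges)
      then have i: "i \<in> Ob J" "d \<in> edges (FO D i)" by (auto simp: ES_def)
      show "he (inv_into ES ce e) \<in> edges Y"
        using d i emap_in[OF sH] by (simp add: he_inv) (simp add: he_def)
      have "hv (inv_into VS cv (cv (i, v))) = vmap (s i) v" if "v \<in> ends (FO D i) d" for v
        using that sub[OF d(1)] i hv_inv[of "(i, v)"] by (auto simp: VS_def hv_def)
      then show "ends Y (he (inv_into ES ce e)) = (\<lambda>v. hv (inv_into VS cv v)) ` ends G e"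
        using d(1) i ends_emap[OF sH[OF i(1)] i(2)]
        by (simp add: d(2) he_inv endsG image_image) (simp add: he_def)
    qed
    show "\<exists>!u. u \<in> Hom Mult G Y \<and> (\<forall>i\<in>Ob J. u \<cdot>\<^bsub>Hyp\<^esub> t i = s i)"
    proof (intro ex1I[of _ u] conjI ballI uH)
      fix i assume i: "i \<in> Ob J"
      show "u \<cdot>\<^bsub>Hyp\<^esub> t i = s i"
        by (rule comp_eqI[OF Hom_Mult_Hyp[OF tH[OF i]] Hom_Mult_Hyp[OF uH] sH[OF i]])
          (use i in \<open>auto simp: t_def uv ue VS_def ES_def\<close>, auto simp: hv_def he_def)
    next
      fix w assume w: "w \<in> Hom Mult G Y \<and> (\<forall>i\<in>Ob J. w \<cdot>\<^bsub>Hyp\<^esub> t i = s i)"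
      then have wH: "w \<in> Hom Hyp G Y" by (simp add: Hom_Mult)
      show "w = u"
      proof (rule hmor_eqI[OF wH Hom_Mult_Hyp[OF uH]])
        fix x assume "x \<in> verts G"
        then obtain i v where v: "(i, v) \<in> VS" "x = cv (i, v)" by (auto simp: verts)
        then have i: "i \<in> Ob J" "v \<in> verts (FO D i)" by (auto simp: VS_def)
        have "vmap w (vmap (t i) v) = vmap (s i) v"
          using w i vmap_comp[OF Hom_Mult_Hyp[OF tH[OF i(1)]] i(2), of w] by simp
        then show "vmap w x = vmap u x"
          using v i by (simp add: uv) (simp add: t_def hv_def)
      next
        fix x assume "x \<in> edges G"
        then obtain i e where e: "(i, e) \<in> ES" "x = ce (i, e)" by (auto simp: edges)
        then have i: "i \<in> Ob J" "e \<in> edges (FO D i)" by (auto simp: ES_def)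
        have "emap w (emap (t i) e) = emap (s i) e"
          using w i emap_comp[OF Hom_Mult_Hyp[OF tH[OF i(1)]] i(2), of w] by simp
        then show "emap w x = emap u x"
          using e i by (simp add: ue) (simp add: t_def he_def)
      qed
    qed
  qed
  then show ?thesis by (rule that)
qed

end

section \<open>Regularity\<close>

lemma pullbackD:
  assumes "is_pullback Mult f g p q"
  shows "f \<in> Hom Mult (src f) (tgt f)" "g \<in> Hom Mult (src g) (tgt f)"
    "p \<in> Hom Mult (src p) (src f)" "q \<in> Hom Mult (src p) (src g)"
    "f \<cdot>\<^bsub>Hyp\<^esub> p = g \<cdot>\<^bsub>Hyp\<^esub> q" "src q = src p"
  using assms unfolding is_pullback_def Arr_Mult_Hom Dom_Mult Cod_Mult Comp_Mult by metis+

context universe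
begin

lemma Mult_coequalizer:
  fixes f g :: "'u hmor"
  assumes "f \<in> Hom Mult X Y" "g \<in> Hom Mult X Y"
  obtains e where "is_coequalizer Mult f g e"
proof -
  \<comment> \<open>A parallel pair as a graph shape: arrow \<open>False\<close> will carry
    \<open>f\<close> and arrow \<open>True\<close> will carry \<open>g\<close>, both from object
    \<open>False\<close> to object \<open>True\<close>.\<close>
  define J :: "(bool, bool) cat" where
    "J = \<lparr>Ob = UNIV, Arr = UNIV, Dom = (\<lambda>_. False), Cod = (\<lambda>_. True), Id = id, Comp = (\<and>)\<rparr>"
  define D where "D = \<lparr>FO = (\<lambda>b. if b then Y else X), FA = (\<lambda>b. if b then g else f)\<rparr>"
  have "is_diagram J Mult D"
    using assms by (auto simp: is_diagram_def J_def D_def Hom_Mult)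
  moreover have "usmall U (Ob J)"
    by (simp add: J_def usmall_finite)
  ultimately obtain Q t where Q: "is_colimit J Mult D Q t"
    by (rule Mult_colimit)
  have cocone: "is_cocone J Mult D Z s \<longleftrightarrow> multigraph Z \<and> s True \<in> Hom Mult Y Z \<and>
      s False \<in> Hom Mult X Z \<and> s True \<cdot>\<^bsub>Hyp\<^esub> f = s False \<and> s True \<cdot>\<^bsub>Hyp\<^esub> g = s False" for Z s
    by (auto simp: is_cocone_def J_def D_def UNIV_bool)
  have fg: "src f = X" "tgt f = Y" "src g = X" "tgt g = Y"
    using assms by (auto simp: Hom_Mult Hom_Hyp)
  have t: "t True \<in> Hom Mult Y Q" "tgt (t True) = Q" "t True \<cdot>\<^bsub>Hyp\<^esub> f = t False" "t True \<cdot>\<^bsub>Hyp\<^esub> g = t False"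
    using Q by (auto simp: is_colimit_def cocone Hom_Mult Hom_Hyp)
  have "is_coequalizer Mult f g (t True)"
    unfolding is_coequalizer_def Dom_Mult Cod_Mult Comp_Mult fg t(2)
  proof (intro conjI ballI impI)
    show "f \<in> Arr Mult" "g \<in> Hom Mult X Y" using assms by (auto simp: Arr_Mult_Hom fg)
    show "t True \<in> Hom Mult Y Q" "t True \<cdot>\<^bsub>Hyp\<^esub> f = t True \<cdot>\<^bsub>Hyp\<^esub> g"
      using t by auto
  next
    fix Z h assume h: "h \<in> Hom Mult Y Z" "h \<cdot>\<^bsub>Hyp\<^esub> f = h \<cdot>\<^bsub>Hyp\<^esub> g"
    have "is_cocone J Mult D Z (\<lambda>b. if b then h else h \<cdot>\<^bsub>Hyp\<^esub> f)"
      using h assms by (auto simp: cocone intro: comp_Mult) (simp add: Hom_Mult)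
    then have "\<exists>!u. u \<in> Hom Mult Q Z \<and> (\<forall>b\<in>Ob J. u \<cdot>\<^bsub>Hyp\<^esub> t b = (if b then h else h \<cdot>\<^bsub>Hyp\<^esub> f))"
      using Q unfolding is_colimit_def Comp_Mult by blast
    \<comment> \<open>The leg at \<open>False\<close> is the leg at \<open>True\<close> preceded by
      \<open>f\<close>, so agreement at \<open>True\<close> implies agreement at
      \<open>False\<close>.\<close>
    moreover have "(\<forall>b\<in>Ob J. u \<cdot>\<^bsub>Hyp\<^esub> t b = (if b then h else h \<cdot>\<^bsub>Hyp\<^esub> f)) \<longleftrightarrow> u \<cdot>\<^bsub>Hyp\<^esub> t True = h"
      if u: "u \<in> Hom Mult Q Z" for u
    proof -
      have "(u \<cdot>\<^bsub>Hyp\<^esub> t True) \<cdot>\<^bsub>Hyp\<^esub> f = u \<cdot>\<^bsub>Hyp\<^esub> t False"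
        using comp_assoc assms(1) t u by (metis Hom_Mult)
      then show ?thesis by (auto simp: J_def UNIV_bool)
    qed
    ultimately show "\<exists>!u. u \<in> Hom Mult Q Z \<and> u \<cdot>\<^bsub>Hyp\<^esub> t True = h"
      by (metis (no_types, lifting))
  qed
  then show ?thesis by (rule that)
qed

lemma Mult_pullback:
  fixes f g :: "'u hmor"
  assumes "f \<in> Hom Mult X Z" "g \<in> Hom Mult Y Z"
  obtains p q where "is_pullback Mult f g p q"
proof -
  \<comment> \<open>A cospan as a graph shape: arrows \<open>0\<close> and \<open>1\<close> run from
    the objects of the same name to the common target \<open>2\<close>.\<close>
  define J :: "(nat, nat) cat" where
    "J = \<lparr>Ob = {0, 1, 2}, Arr = {0, 1}, Dom = (\<lambda>n. n), Cod = (\<lambda>_. 2), Id = id, Comp = (+)\<rparr>"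
  define D where "D = \<lparr>FO = (\<lambda>n::nat. if n = 0 then X else if n = 1 then Y else Z),
    FA = (\<lambda>n::nat. if n = 0 then f else g)\<rparr>"
  have "is_diagram J Mult D"
    using assms by (auto simp: is_diagram_def J_def D_def Hom_Mult)
  moreover have "usmall U (Ob J)"
    by (simp add: J_def usmall_finite)
  ultimately obtain P t where P: "is_limit J Mult D P t"
    by (rule Mult_limit)
  have cone: "is_cone J Mult D W s \<longleftrightarrow> multigraph W \<and> s 0 \<in> Hom Mult W X \<and> s 1 \<in> Hom Mult W Y \<and>
      s 2 \<in> Hom Mult W Z \<and> f \<cdot>\<^bsub>Hyp\<^esub> s 0 = s 2 \<and> g \<cdot>\<^bsub>Hyp\<^esub> s 1 = s 2" for W s
    by (auto simp: is_cone_def J_def D_def)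
  have fg: "src f = X" "tgt f = Z" "src g = Y" "tgt g = Z"
    using assms by (auto simp: Hom_Mult Hom_Hyp)
  have t: "t 0 \<in> Hom Mult P X" "t 1 \<in> Hom Mult P Y" "src (t 0) = P" "src (t 1) = P"
    "f \<cdot>\<^bsub>Hyp\<^esub> t 0 = t 2" "g \<cdot>\<^bsub>Hyp\<^esub> t 1 = t 2"
    using P by (auto simp: is_limit_def cone Hom_Mult Hom_Hyp)
  have "is_pullback Mult f g (t 0) (t 1)"
    unfolding is_pullback_def Dom_Mult Cod_Mult Comp_Mult fg t(3,4)
  proof (intro conjI ballI impI)
    show "f \<in> Arr Mult" "g \<in> Arr Mult" using assms by (auto simp: Arr_Mult_Hom fg)
    show "t 0 \<in> Hom Mult P X" "t 1 \<in> Hom Mult P Y" "f \<cdot>\<^bsub>Hyp\<^esub> t 0 = g \<cdot>\<^bsub>Hyp\<^esub> t 1"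
      using t by auto
  next
    fix W p q assume h: "p \<in> Hom Mult W X" "q \<in> Hom Mult W Y" "f \<cdot>\<^bsub>Hyp\<^esub> p = g \<cdot>\<^bsub>Hyp\<^esub> q"
    define s where "s n = (if n = 0 then p else if n = 1 then q else f \<cdot>\<^bsub>Hyp\<^esub> p)" for n :: nat
    have s: "s 0 = p" "s 1 = q" "s 2 = f \<cdot>\<^bsub>Hyp\<^esub> p" by (simp_all add: s_def)
    have "is_cone J Mult D W s"
      using h assms comp_Mult[OF h(1) assms(1)] by (simp add: cone s Hom_Mult del: One_nat_def)
    then have "\<exists>!u. u \<in> Hom Mult W P \<and> (\<forall>n\<in>Ob J. t n \<cdot>\<^bsub>Hyp\<^esub> u = s n)"
      using P unfolding is_limit_def Comp_Mult by blast
    moreover have "(\<forall>n\<in>Ob J. t n \<cdot>\<^bsub>Hyp\<^esub> u = s n) \<longleftrightarrow> t 0 \<cdot>\<^bsub>Hyp\<^esub> u = p \<and> t 1 \<cdot>\<^bsub>Hyp\<^esub> u = q"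
      if u: "u \<in> Hom Mult W P" for u
    proof -
      have "t 2 \<cdot>\<^bsub>Hyp\<^esub> u = f \<cdot>\<^bsub>Hyp\<^esub> (t 0 \<cdot>\<^bsub>Hyp\<^esub> u)"
        using comp_assoc assms(1) t u by (metis Hom_Mult)
      then show ?thesis using s by (auto simp: J_def)
    qed
    ultimately show "\<exists>!u. u \<in> Hom Mult W P \<and> t 0 \<cdot>\<^bsub>Hyp\<^esub> u = p \<and> t 1 \<cdot>\<^bsub>Hyp\<^esub> u = q"
      by (metis (no_types, lifting))
  qed (rule refl)+
  then show ?thesis by (rule that)
qed

text \<open>Forward: a coequalizer \<open>e\<close> factors through the subgraph formed by its
  image, and uniqueness of factorizations makes the inclusion of that subgraph split, hence onto.
  Backward: \<open>e\<close> is a coequalizer of its kernel pair, because two vertices or edges with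
  the same image under \<open>e\<close> come from an element of the kernel pair.\<close>

lemma regular_epi_iff:
  "regular_epi Mult (e :: 'u hmor) \<longleftrightarrow> e \<in> Arr Mult \<and>
     vmap e ` verts (src e) = verts (tgt e) \<and> emap e ` edges (src e) = edges (tgt e)"
proof (intro iffI)
  assume "regular_epi Mult e"
  then obtain f g where c: "is_coequalizer Mult f g e" by (auto simp: regular_epi_def)
  then have f: "f \<in> Hom Hyp (src f) (tgt f)" and g: "g \<in> Hom Hyp (src f) (tgt f)"
    and e: "e \<in> Hom Mult (tgt f) (tgt e)" and eq: "e \<cdot>\<^bsub>Hyp\<^esub> f = e \<cdot>\<^bsub>Hyp\<^esub> g"
    by (auto simp: is_coequalizer_def Arr_Mult_Hom Hom_Mult)
  have eH: "e \<in> Hom Hyp (tgt f) (tgt e)" and mB: "multigraph (tgt f)" and mC: "multigraph (tgt e)"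
    using e by (auto simp: Hom_Mult)
  have [simp]: "src e = tgt f" using e by (simp add: Hom_Mult Hom_Hyp)
  \<comment> \<open>The image subgraph; it is closed under taking ends because \<open>e\<close> maps
    ends onto ends.\<close>
  define I where "I = \<lparr>verts = vmap e ` verts (tgt f), edges = emap e ` edges (tgt f),
    ends = restrict (ends (tgt e)) (emap e ` edges (tgt f))\<rparr>"
  have Isub: "verts I \<subseteq> verts (tgt e)" "edges I \<subseteq> edges (tgt e)"
    using vmap_in[OF eH] emap_in[OF eH] by (auto simp: I_def)
  have Iends: "ends I x = ends (tgt e) x" if "x \<in> edges I" for x
    using that by (auto simp: I_def)
  have "ends I x \<subseteq> verts I" if x: "x \<in> edges I" for x
  proof -
    obtain d where d: "d \<in> edges (tgt f)" "x = emap e d" using x by (auto simp: I_def)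
    then have "ends I x = vmap e ` ends (tgt f) d" by (simp add: I_def ends_emap[OF eH])
    also have "\<dots> \<subseteq> verts I"
      using ends_subset[OF multigraph_hypergraph[OF mB] d(1)] by (simp add: I_def image_mono)
    finally show ?thesis .
  qed
  then have "ends I \<in> edges I \<rightarrow>\<^sub>E Pow (verts I)"
    by (intro PiE_I) (simp_all add: I_def)
  then have "hypergraph I"
    using Isub multigraph_hypergraph[OF mC] by (auto simp: hypergraph_def intro: small_subset)
  then have mI: "multigraph I"
    using mC Isub Iends by (auto simp: multigraph_def)
  define e' where "e' = hmor_of (tgt f) I (vmap e) (emap e)"
  define i where "i = hmor_of I (tgt e) (\<lambda>v. v) (\<lambda>x. x)"
  have e'H: "e' \<in> Hom Mult (tgt f) I"
    unfolding e'_def by (rule hmor_of_Mult[OF mB mI]) (auto simp: I_def ends_emap[OF eH])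
  have iH: "i \<in> Hom Mult I (tgt e)"
    unfolding i_def by (rule hmor_of_Mult[OF mI mC]) (use Isub Iends in auto)
  note e'H' = Hom_Mult_Hyp[OF e'H] and iH' = Hom_Mult_Hyp[OF iH]
  have "e' \<cdot>\<^bsub>Hyp\<^esub> f = e' \<cdot>\<^bsub>Hyp\<^esub> g"
    by (rule comp_eqI[OF f e'H' comp_Hyp[OF g e'H']])
      (use comp_eqD[OF eq f g] vmap_in[OF f] vmap_in[OF g] emap_in[OF f] emap_in[OF g] in
        \<open>auto simp: vmap_comp[OF g] emap_comp[OF g] e'_def\<close>)
  then obtain u where u: "u \<in> Hom Mult (tgt e) I" "u \<cdot>\<^bsub>Hyp\<^esub> e = e'"
    using c e'H mI unfolding is_coequalizer_def by (metis Cod_Mult Comp_Mult Ob_Mult)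
  note uH = Hom_Mult_Hyp[OF u(1)]
  have ie': "i \<cdot>\<^bsub>Hyp\<^esub> e' = e"
    by (rule comp_eqI[OF e'H' iH' eH]) (auto simp: i_def e'_def I_def)
  have "\<exists>!w. w \<in> Hom Mult (tgt e) (tgt e) \<and> w \<cdot>\<^bsub>Hyp\<^esub> e = e"
    using c mC e eq unfolding is_coequalizer_def by (metis Cod_Mult Comp_Mult Ob_Mult)
  moreover have "i \<cdot>\<^bsub>Hyp\<^esub> u \<in> Hom Mult (tgt e) (tgt e)" using u(1) iH by (rule comp_Mult)
  moreover have "(i \<cdot>\<^bsub>Hyp\<^esub> u) \<cdot>\<^bsub>Hyp\<^esub> e = e"
    using category.Comp_assoc[OF category_Hyp eH uH iH'] u(2) ie' by simp
  moreover have "Id Hyp (tgt e) \<in> Hom Mult (tgt e) (tgt e)"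
    using mC by (simp add: Hom_Mult Id_Hyp multigraph_hypergraph)
  moreover have "Id Hyp (tgt e) \<cdot>\<^bsub>Hyp\<^esub> e = e"
    by (rule category.Id_Comp[OF category_Hyp eH])
  \<comment> \<open>Both \<open>i\<close> after \<open>u\<close> and the identity factor
    \<open>e\<close> through itself.\<close>
  ultimately have iu: "i \<cdot>\<^bsub>Hyp\<^esub> u = Id Hyp (tgt e)" by blast
  have "verts (tgt e) \<subseteq> verts I"
  proof
    fix v assume v: "v \<in> verts (tgt e)"
    have "vmap u v = v"
      using vmap_comp[OF uH v, of i] vmap_in[OF uH v] v by (simp add: iu) (simp add: i_def)
    with vmap_in[OF uH v] show "v \<in> verts I" by simp
  qed
  moreover have "edges (tgt e) \<subseteq> edges I"
  proof
    fix v assume v: "v \<in> edges (tgt e)"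
    have "emap u v = v"
      using emap_comp[OF uH v, of i] emap_in[OF uH v] v by (simp add: iu) (simp add: i_def)
    with emap_in[OF uH v] show "v \<in> edges I" by simp
  qed
  ultimately show "e \<in> Arr Mult \<and> vmap e ` verts (src e) = verts (tgt e) \<and> emap e ` edges (src e) = edges (tgt e)"
    using Isub e by (simp add: I_def Arr_Mult_Hom subset_antisym)
next
  assume e: "e \<in> Arr Mult \<and> vmap e ` verts (src e) = verts (tgt e) \<and> emap e ` edges (src e) = edges (tgt e)"
  then have eM: "e \<in> Hom Mult (src e) (tgt e)" and eH: "e \<in> Hom Hyp (src e) (tgt e)"
    by (auto simp: Arr_Mult_Hom Hom_Mult)
  have surj: "verts (tgt e) = vmap e ` verts (src e)" "edges (tgt e) = emap e ` edges (src e)"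
    using e by auto
  obtain p q where pb: "is_pullback Mult e e p q"
    by (rule Mult_pullback[OF eM eM])
  note p = pullbackD(3)[OF pb] and q = pullbackD(4)[OF pb]
  have tp: "tgt p = src e" using p by (simp add: Hom_def)
  note pH = Hom_Mult_Hyp[OF p] and qH = Hom_Mult_Hyp[OF q]
  have "is_coequalizer Mult p q e"
    unfolding is_coequalizer_def Dom_Mult Cod_Mult Comp_Mult tp
  proof (intro conjI ballI impI)
    show "p \<in> Arr Mult" using p by (simp add: Hom_def)
  next
    fix X h assume h: "h \<in> Hom Mult (src e) X" "h \<cdot>\<^bsub>Hyp\<^esub> p = h \<cdot>\<^bsub>Hyp\<^esub> q"
    have hH: "h \<in> Hom Hyp (src e) X" using h(1) by (rule Hom_Mult_Hyp)
    have hv: "vmap h v = vmap h w"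
      if vw: "v \<in> verts (src e)" "w \<in> verts (src e)" "vmap e v = vmap e w" for v w
    proof -
      obtain k where "k \<in> verts (src p)" "vmap p k = v" "vmap q k = w"
        by (rule pullback_vertex[OF pb vw])
      then show ?thesis using comp_eqD(1)[OF h(2) pH qH] by metis
    qed
    have he: "emap h v = emap h w"
      if vw: "v \<in> edges (src e)" "w \<in> edges (src e)" "emap e v = emap e w" for v w
    proof -
      obtain k where "k \<in> edges (src p)" "emap p k = v" "emap q k = w"
        by (rule pullback_edge[OF pb vw])
      then show ?thesis using comp_eqD(2)[OF h(2) pH qH] by metis
    qed
    \<comment> \<open>Values are read off at chosen preimages; \<open>hv\<close> and
      \<open>he\<close> make them independent of the choice.\<close>
    define u where "u = hmor_of (tgt e) X (\<lambda>v. vmap h (inv_into (verts (src e)) (vmap e) v))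
      (\<lambda>v. emap h (inv_into (edges (src e)) (emap e) v))"
    have iv: "vmap h (inv_into (verts (src e)) (vmap e) (vmap e v)) = vmap h v" if "v \<in> verts (src e)" for v
      using that by (intro hv) (auto intro: inv_into_into f_inv_into_f)
    have ie: "emap h (inv_into (edges (src e)) (emap e) (emap e v)) = emap h v" if "v \<in> edges (src e)" for v
      using that by (intro he) (auto intro: inv_into_into f_inv_into_f)
    have uH: "u \<in> Hom Mult (tgt e) X"
      unfolding u_def
    proof (rule hmor_of_Mult)
      show "multigraph (tgt e)" "multigraph X" using eM h(1) by (auto simp: Hom_Mult)
    next
      fix x assume "x \<in> edges (tgt e)"
      then obtain d where d: "d \<in> edges (src e)" "x = emap e d" by (auto simp: surj)
      have "ends (src e) d \<subseteq> verts (src e)"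
        using ends_subset[OF Hom_srctgt(3)[OF eH] d(1)] .
      then show "ends X (emap h (inv_into (edges (src e)) (emap e) x)) =
          (\<lambda>v. vmap h (inv_into (verts (src e)) (vmap e) v)) ` ends (tgt e) x"
        using d by (auto simp: ie ends_emap[OF eH] ends_emap[OF hH] image_image iv intro!: image_cong)
    qed (auto simp: surj iv ie vmap_in[OF hH] emap_in[OF hH])
    show "\<exists>!u. u \<in> Hom Mult (tgt e) X \<and> u \<cdot>\<^bsub>Hyp\<^esub> e = h"
    proof (intro ex1I[of _ u] conjI uH)
      show "u \<cdot>\<^bsub>Hyp\<^esub> e = h"
        by (rule comp_eqI[OF eH Hom_Mult_Hyp[OF uH] hH]) (auto simp: u_def surj iv ie)
    next
      fix w assume w: "w \<in> Hom Mult (tgt e) X \<and> w \<cdot>\<^bsub>Hyp\<^esub> e = h"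
      then have wH: "w \<in> Hom Hyp (tgt e) X" and we: "w \<cdot>\<^bsub>Hyp\<^esub> e = h"
        by (auto simp: Hom_Mult)
      show "w = u"
      proof (rule hmor_eqI[OF wH Hom_Mult_Hyp[OF uH]])
        fix x assume "x \<in> verts (tgt e)"
        then obtain v where v: "v \<in> verts (src e)" "x = vmap e v" by (auto simp: surj)
        then show "vmap w x = vmap u x"
          using vmap_comp[OF eH v(1), of w] by (simp add: we u_def surj iv)
      next
        fix x assume "x \<in> edges (tgt e)"
        then obtain v where v: "v \<in> edges (src e)" "x = emap e v" by (auto simp: surj)
        then show "emap w x = emap u x"
          using emap_comp[OF eH v(1), of w] by (simp add: we u_def surj ie)
      qed
    qed
  qed (use q eM pullbackD(5)[OF pb] in simp_all)
  then show "regular_epi Mult e" by (auto simp: regular_epi_def)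
qed

text \<open>Surjectivity passes to pullbacks because elements of \<open>src f\<close> and
  \<open>src g\<close> with a common image lift; kernel pairs have coequalizers because all parallel
  pairs do.\<close>

theorem Mult_regular: "regular (Mult :: ('u hypergraph, 'u hmor) cat)"
  unfolding regular_def
proof (intro conjI allI impI)
  show "finitely_complete (Mult :: ('u hypergraph, 'u hmor) cat)"
    unfolding finitely_complete_def
  proof (intro allI impI)
    fix J :: "(nat, nat) cat" and D :: "(nat, nat, 'u hypergraph, 'u hmor) func"
    assume "category J \<and> finite (Ob J) \<and> finite (Arr J) \<and> is_functor J Mult D"
    then show "\<exists>X t. is_limit J Mult D X t"
      using Mult_limit[OF is_functor_diagram usmall_finite] by metis
  qed
next
  fix f p q :: "'u hmor"
  assume "is_pullback Mult f f p q"
  then have "p \<in> Hom Mult (src p) (src f)" "q \<in> Hom Mult (src p) (src f)"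
    by (auto simp: is_pullback_def)
  then show "\<exists>e. is_coequalizer Mult p q e" by (metis Mult_coequalizer)
next
  fix f g p q :: "'u hmor"
  assume A: "is_pullback Mult f g p q \<and> regular_epi Mult f"
  then have pb: "is_pullback Mult f g p q"
    and f: "vmap f ` verts (src f) = verts (tgt f)" "emap f ` edges (src f) = edges (tgt f)"
    by (auto simp: regular_epi_iff)
  have g: "g \<in> Hom Hyp (src g) (tgt f)" and q: "q \<in> Hom Mult (src p) (src g)"
    using pb by (auto simp: is_pullback_def Arr_Mult_Hom Hom_Mult)
  then have qH: "q \<in> Hom Hyp (src p) (src g)" and [simp]: "src q = src p" "tgt q = src g"
    by (auto simp: Hom_Mult Hom_Hyp)
  show "regular_epi Mult q"
    unfolding regular_epi_iff
  proof (intro conjI subset_antisym subsetI)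
    show "q \<in> Arr Mult" using q by (simp add: Hom_def)
  next
    fix w assume w: "w \<in> verts (tgt q)"
    then obtain v where "v \<in> verts (src f)" "vmap f v = vmap g w"
      using vmap_in[OF g, of w] f(1) by (auto simp: image_iff dest!: equalityD2)
    with w obtain k where "k \<in> verts (src p)" "vmap q k = w"
      using pullback_vertex[OF pb, of v w] by auto
    then show "w \<in> vmap q ` verts (src q)" by auto
  next
    fix w assume w: "w \<in> edges (tgt q)"
    then obtain v where "v \<in> edges (src f)" "emap f v = emap g w"
      using emap_in[OF g, of w] f(2) by (auto simp: image_iff dest!: equalityD2)
    with w obtain k where "k \<in> edges (src p)" "emap q k = w"
      using pullback_edge[OF pb, of v w] by auto
    then show "w \<in> emap q ` edges (src q)" by auto
  qed (auto simp: vmap_in[OF qH] emap_in[OF qH])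
qed

end

section \<open>Partial morphism representers and injective envelopes\<close>

text \<open>As \<open>g\<close> is injective, a competing pair is determined by its leg into
  \<open>K\<close>. By \<open>vpre\<close> and \<open>epre\<close> whatever meets the image of
  \<open>g\<close> comes from \<open>H\<close>, so this leg lifts through the injective
  \<open>p\<close>. The criterion serves for the classifying squares of partial morphisms.\<close>

lemma pullback_injI:
  assumes f: "f \<in> Hom Mult K T" and g: "g \<in> Hom Mult G T" and p: "p \<in> Hom Mult H K" and q: "q \<in> Hom Mult H G"
    and eq: "f \<cdot>\<^bsub>Hyp\<^esub> p = g \<cdot>\<^bsub>Hyp\<^esub> q"
    and g_inj: "inj_on (vmap g) (verts G)" "inj_on (emap g) (edges G)"
    and p_inj: "inj_on (vmap p) (verts H)" "inj_on (emap p) (edges H)"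
    and vpre: "\<And>v w. v \<in> verts K \<Longrightarrow> w \<in> verts G \<Longrightarrow> vmap f v = vmap g w \<Longrightarrow> v \<in> vmap p ` verts H"
    and epre: "\<And>d e. d \<in> edges K \<Longrightarrow> e \<in> edges G \<Longrightarrow> emap f d = emap g e \<Longrightarrow> d \<in> emap p ` edges H"
  shows "is_pullback Mult f g p q"
proof -
  note fH = Hom_Mult_Hyp[OF f] and gH = Hom_Mult_Hyp[OF g]
    and pH = Hom_Mult_Hyp[OF p] and qH = Hom_Mult_Hyp[OF q]
  have simps: "src f = K" "tgt f = T" "src g = G" "tgt g = T" "src p = H" "src q = H"
    using fH gH pH qH by (auto simp: Hom_Hyp)
  show ?thesis
    unfolding is_pullback_def Dom_Mult Cod_Mult Comp_Mult simps
  proof (intro conjI ballI impI)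
    fix X p' q' assume p': "p' \<in> Hom Mult X K" and q': "q' \<in> Hom Mult X G"
      and eq': "f \<cdot>\<^bsub>Hyp\<^esub> p' = g \<cdot>\<^bsub>Hyp\<^esub> q'"
    note p'H = Hom_Mult_Hyp[OF p'] and q'H = Hom_Mult_Hyp[OF q']
    define uv where "uv v = inv_into (verts H) (vmap p) (vmap p' v)" for v
    define ue where "ue e = inv_into (edges H) (emap p) (emap p' e)" for e
    have v_im: "vmap p' v \<in> vmap p ` verts H" if "v \<in> verts X" for v
      by (rule vpre[OF vmap_in[OF p'H that] vmap_in[OF q'H that] comp_eqD(1)[OF eq' p'H q'H that]])
    have e_im: "emap p' e \<in> emap p ` edges H" if "e \<in> edges X" for e
      by (rule epre[OF emap_in[OF p'H that] emap_in[OF q'H that] comp_eqD(2)[OF eq' p'H q'H that]])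
    have uv: "uv v \<in> verts H" "vmap p (uv v) = vmap p' v" if "v \<in> verts X" for v
      using v_im[OF that] by (auto simp: uv_def intro: inv_into_into f_inv_into_f)
    have ue: "ue e \<in> edges H" "emap p (ue e) = emap p' e" if "e \<in> edges X" for e
      using e_im[OF that] by (auto simp: ue_def intro: inv_into_into f_inv_into_f)
    have uends: "ends H (ue e) = uv ` ends X e" if e: "e \<in> edges X" for e
    proof -
      note sub = ends_subset[OF Hom_srctgt(3)[OF p'H] e]
      \<comment> \<open>The equation of ends is verified after \<open>p\<close>, where both sides
        are known, and pulled back by injectivity.\<close>
      have "vmap p ` ends H (ue e) = vmap p' ` ends X e"
        using ends_emap[OF pH ue(1)[OF e]] ends_emap[OF p'H e] by (simp add: ue e)
      also have "\<dots> = vmap p ` uv ` ends X e"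
        using sub by (auto simp: image_image uv intro!: image_cong)
      finally show ?thesis
        using inj_on_image_eq_iff[OF p_inj(1)] ends_subset[OF Hom_srctgt(3)[OF pH] ue(1)[OF e]] sub uv(1)
        by (metis (no_types, lifting) image_subset_iff subset_iff)
    qed
    define u where "u = hmor_of X H uv ue"
    have uM: "u \<in> Hom Mult X H"
      unfolding u_def using p p' by (intro hmor_of_Mult) (auto simp: Hom_Mult uv ue uends)
    note uH = Hom_Mult_Hyp[OF uM]
    show "\<exists>!u. u \<in> Hom Mult X H \<and> p \<cdot>\<^bsub>Hyp\<^esub> u = p' \<and> q \<cdot>\<^bsub>Hyp\<^esub> u = q'"
    proof (intro ex1I[of _ u] conjI uM)
      show pu: "p \<cdot>\<^bsub>Hyp\<^esub> u = p'"
        by (rule comp_eqI[OF uH pH p'H]) (auto simp: u_def uv ue)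
      show "q \<cdot>\<^bsub>Hyp\<^esub> u = q'"
      proof (rule comp_eqI[OF uH qH q'H])
        fix v assume v: "v \<in> verts X"
        have "vmap g (vmap q (vmap u v)) = vmap f (vmap p (vmap u v))"
          using comp_eqD(1)[OF eq pH qH vmap_in[OF uH v]] by simp
        also have "\<dots> = vmap g (vmap q' v)"
          using comp_eqD(1)[OF eq' p'H q'H v] v by (simp add: u_def uv)
        finally show "vmap q (vmap u v) = vmap q' v"
          using g_inj(1) vmap_in[OF qH vmap_in[OF uH v]] vmap_in[OF q'H v] by (simp add: inj_on_eq_iff)
      next
        fix v assume v: "v \<in> edges X"
        have "emap g (emap q (emap u v)) = emap f (emap p (emap u v))"
          using comp_eqD(2)[OF eq pH qH emap_in[OF uH v]] by simp
        also have "\<dots> = emap g (emap q' v)"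
          using comp_eqD(2)[OF eq' p'H q'H v] v by (simp add: u_def ue)
        finally show "emap q (emap u v) = emap q' v"
          using g_inj(2) emap_in[OF qH emap_in[OF uH v]] emap_in[OF q'H v] by (simp add: inj_on_eq_iff)
      qed
    next
      fix w assume w: "w \<in> Hom Mult X H \<and> p \<cdot>\<^bsub>Hyp\<^esub> w = p' \<and> q \<cdot>\<^bsub>Hyp\<^esub> w = q'"
      then have wH: "w \<in> Hom Hyp X H" and pw: "p \<cdot>\<^bsub>Hyp\<^esub> w = p'" by (auto simp: Hom_Mult)
      show "w = u"
      proof (rule hmor_eqI[OF wH uH])
        fix v assume v: "v \<in> verts X"
        have "vmap p (vmap w v) = vmap p (vmap u v)"
          using vmap_comp[OF wH v, of p] v by (simp add: pw u_def uv)
        then show "vmap w v = vmap u v"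
          using p_inj(1) vmap_in[OF wH v] vmap_in[OF uH v] by (simp add: inj_on_eq_iff)
      next
        fix v assume v: "v \<in> edges X"
        have "emap p (emap w v) = emap p (emap u v)"
          using emap_comp[OF wH v, of p] v by (simp add: pw u_def ue)
        then show "emap w v = emap u v"
          using p_inj(2) emap_in[OF wH v] emap_in[OF uH v] by (simp add: inj_on_eq_iff)
      qed
    qed
  qed (use f g p q eq in \<open>simp_all add: Hom_def\<close>)
qed

context universe
begin

theorem Mult_partial_morphism_representer:
  fixes G :: "'u hypergraph"
  assumes mG: "multigraph G"
  obtains \<eta> where "partial_morphism_representer Mult G \<eta>"
proof -
  note hG = multigraph_hypergraph[OF mG]
  define V where "V = insert None (Some ` verts G)"
  \<comment> \<open>\<open>Inl\<close> keeps the edges of \<open>G\<close>; \<open>Inr\<close> adds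
    exactly one edge per admissible set, also for sets that are the ends of an edge of
    \<open>G\<close>. One per set makes classifying maps exist, and having no second makes them
    unique.\<close>
  define E where "E = Inl ` edges G \<union> Inr ` {S. S \<subseteq> V \<and> multi_edge S}"
  define en :: "'u + 'u option set \<Rightarrow> 'u option set" where "en = case_sum (\<lambda>e. Some ` ends G e) (\<lambda>S. S)"
  have small: "usmall U (verts G)" "usmall U (edges G)"
    using hG by (auto simp: hypergraph_def small_def usmall_def)
  have sV: "usmall U V"
    using usmall_Un[OF usmall_finite[of "{None}"] usmall_image[OF small(1), of Some]] by (simp add: V_def)
  have sE: "usmall U E"
    unfolding E_def
    by (intro usmall_Un usmall_image small usmall_subset[OF usmall_Pow[OF sV]]) auto
  have en_sub: "en e \<subseteq> V" if "e \<in> E" for e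
    using that ends_subset[OF hG] by (fastforce simp: E_def en_def V_def)
  obtain T and iv :: "'u option \<Rightarrow> 'u" and ie :: "'u + 'u option set \<Rightarrow> 'u"
    where T: "hypergraph T" "bij_betw iv V (verts T)" "bij_betw ie E (edges T)"
      and ends: "\<And>e. e \<in> E \<Longrightarrow> ends T (ie e) = iv ` en e"
    by (rule hypergraph_of_types[OF sV sE, of en]) (auto intro: en_sub[THEN subsetD])
  have verts: "verts T = iv ` V" and edges: "edges T = ie ` E"
    and iv_inj: "inj_on iv V" and ie_inj: "inj_on ie E"
    using T by (auto simp: bij_betw_def)
  have en_multi: "multi_edge (en e)" if "e \<in> E" for e
    using that mG by (auto simp: E_def en_def multigraph_def multi_edge_image)
  have mT: "multigraph T"
    using T(1) by (auto simp: multigraph_def edges ends multi_edge_image en_multi)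
  define \<eta> where "\<eta> = hmor_of G T (\<lambda>v. iv (Some v)) (\<lambda>e. ie (Inl e))"
  have \<eta>M: "\<eta> \<in> Hom Mult G T"
    unfolding \<eta>_def by (rule hmor_of_Mult[OF mG mT])
      (auto simp: verts edges V_def E_def ends en_def image_image)
  note \<eta>H = Hom_Mult_Hyp[OF \<eta>M]
  have \<eta>v: "vmap \<eta> v = iv (Some v)" if "v \<in> verts G" for v using that by (simp add: \<eta>_def)
  have \<eta>e: "emap \<eta> e = ie (Inl e)" if "e \<in> edges G" for e using that by (simp add: \<eta>_def)
  have [simp]: "src \<eta> = G" "tgt \<eta> = T" by (simp_all add: \<eta>_def)
  have \<eta>_inj: "inj_on (vmap \<eta>) (verts G)" "inj_on (emap \<eta>) (edges G)"
    using inj_onD[OF iv_inj] inj_onD[OF ie_inj]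
    by (auto intro!: inj_onI simp: \<eta>v \<eta>e V_def E_def) blast+
  have "\<exists>!\<psi>'. \<psi>' \<in> Hom Mult (tgt \<phi>) T \<and> is_pullback Mult \<psi>' \<eta> \<phi> \<psi>"
    if \<phi>: "monic Mult \<phi>" and \<psi>: "\<psi> \<in> Hom Mult (src \<phi>) G" for \<phi> \<psi>
  proof -
    define H K where "H = src \<phi>" and "K = tgt \<phi>"
    have \<phi>M: "\<phi> \<in> Hom Mult H K" and \<phi>_inj: "inj_on (vmap \<phi>) (verts H)" "inj_on (emap \<phi>) (edges H)"
      using \<phi> by (auto simp: monic_iff Arr_Mult_Hom H_def K_def)
    have \<psi>M: "\<psi> \<in> Hom Mult H G" using \<psi> by (simp add: H_def)
    note \<phi>H = Hom_Mult_Hyp[OF \<phi>M] and \<psi>H = Hom_Mult_Hyp[OF \<psi>M]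
    have hK: "hypergraph K" and mK: "multigraph K" using \<phi>M by (auto simp: Hom_Mult multigraph_def)
    define gv where "gv v = (if v \<in> vmap \<phi> ` verts H
      then Some (vmap \<psi> (inv_into (verts H) (vmap \<phi>) v)) else None)" for v
    \<comment> \<open>Edges in the image of \<open>\<phi>\<close> follow \<open>\<psi>\<close>; any
      other edge goes to a fresh edge, even if all its ends lie in the image of
      \<open>\<phi>\<close>.\<close>
    define ge where "ge e = (if e \<in> emap \<phi> ` edges H
      then Inl (emap \<psi> (inv_into (edges H) (emap \<phi>) e)) else Inr (gv ` ends K e))" for e
    have gv_\<phi>: "gv (vmap \<phi> v) = Some (vmap \<psi> v)" if "v \<in> verts H" for v
      using that \<phi>_inj by (simp add: gv_def)
    have ge_\<phi>: "ge (emap \<phi> e) = Inl (emap \<psi> e)" if "e \<in> edges H" for e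
      using that \<phi>_inj by (simp add: ge_def)
    have gv_V: "gv v \<in> V" for v
      by (auto simp: gv_def V_def intro!: imageI vmap_in[OF \<psi>H] inv_into_into)
    have en_ge: "en (ge e) = gv ` ends K e" if e: "e \<in> edges K" for e
    proof (cases "e \<in> emap \<phi> ` edges H")
      case True
      then obtain d where d: "d \<in> edges H" "e = emap \<phi> d" by auto
      have "gv ` ends K e = (\<lambda>v. Some (vmap \<psi> v)) ` ends H d"
        using ends_subset[OF Hom_srctgt(3)[OF \<phi>H] d(1)]
        by (auto simp: d(2) ends_emap[OF \<phi>H d(1)] image_image gv_\<phi> intro!: image_cong)
      then show ?thesis
        using d by (simp add: ge_\<phi> en_def ends_emap[OF \<psi>H] image_image)
    qed (simp add: ge_def en_def)
    have ge_E: "ge e \<in> E" if e: "e \<in> edges K" for e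
    proof (cases "e \<in> emap \<phi> ` edges H")
      case True
      then show ?thesis using emap_in[OF \<psi>H] by (auto simp: ge_\<phi> E_def)
    next
      case False
      have "multi_edge (gv ` ends K e)" using mK e by (simp add: multigraph_def multi_edge_image)
      moreover have "gv ` ends K e \<subseteq> V" using gv_V by blast
      ultimately have "Inr (gv ` ends K e) \<in> E" unfolding E_def by blast
      then show ?thesis using False by (simp add: ge_def)
    qed
    define \<theta> where "\<theta> = hmor_of K T (\<lambda>v. iv (gv v)) (\<lambda>e. ie (ge e))"
    have \<theta>M: "\<theta> \<in> Hom Mult K T"
      unfolding \<theta>_def by (rule hmor_of_Mult[OF mK mT])
        (auto simp: verts edges gv_V ge_E ends en_ge image_image)
    note \<theta>H = Hom_Mult_Hyp[OF \<theta>M]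
    have \<theta>v: "vmap \<theta> v = iv (gv v)" if "v \<in> verts K" for v using that by (simp add: \<theta>_def)
    have \<theta>e: "emap \<theta> e = ie (ge e)" if "e \<in> edges K" for e using that by (simp add: \<theta>_def)
    have pb: "is_pullback Mult \<theta> \<eta> \<phi> \<psi>"
    proof (rule pullback_injI[OF \<theta>M \<eta>M \<phi>M \<psi>M _ \<eta>_inj \<phi>_inj])
      show "\<theta> \<cdot>\<^bsub>Hyp\<^esub> \<phi> = \<eta> \<cdot>\<^bsub>Hyp\<^esub> \<psi>"
        by (rule comp_eqI[OF \<phi>H \<theta>H comp_Hyp[OF \<psi>H \<eta>H]])
          (simp_all add: \<theta>v \<theta>e vmap_in[OF \<phi>H] emap_in[OF \<phi>H] gv_\<phi> ge_\<phi> vmap_comp[OF \<psi>H]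
            emap_comp[OF \<psi>H] \<eta>v \<eta>e vmap_in[OF \<psi>H] emap_in[OF \<psi>H])
    next
      fix v w assume vw: "v \<in> verts K" "w \<in> verts G" "vmap \<theta> v = vmap \<eta> w"
      then have "gv v = Some w"
        using inj_onD[OF iv_inj _ gv_V] by (auto simp: \<theta>v \<eta>v V_def)
      then show "v \<in> vmap \<phi> ` verts H" by (auto simp: gv_def split: if_splits)
    next
      fix d e assume de: "d \<in> edges K" "e \<in> edges G" "emap \<theta> d = emap \<eta> e"
      then have "ge d = Inl e"
        using inj_onD[OF ie_inj _ ge_E[OF de(1)]] by (auto simp: \<theta>e \<eta>e E_def)
      then show "d \<in> emap \<phi> ` edges H" by (auto simp: ge_def split: if_splits)
    qed
    have "w = \<theta>" if w: "w \<in> Hom Mult K T" "is_pullback Mult w \<eta> \<phi> \<psi>" for w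
    proof -
      note wH = Hom_Mult_Hyp[OF w(1)]
      have [simp]: "src w = K" "src \<phi> = H" using wH by (auto simp: Hom_Hyp H_def)
      have comm: "w \<cdot>\<^bsub>Hyp\<^esub> \<phi> = \<eta> \<cdot>\<^bsub>Hyp\<^esub> \<psi>" by (rule pullbackD(5)[OF w(2)])
      have wv: "vmap w v = iv (gv v)" if v: "v \<in> verts K" for v
      proof (cases "v \<in> vmap \<phi> ` verts H")
        case True
        then obtain h where h: "h \<in> verts H" "v = vmap \<phi> h" by auto
        then show ?thesis
          using comp_eqD(1)[OF comm \<phi>H \<psi>H h(1)] vmap_in[OF \<psi>H h(1)] by (simp add: gv_\<phi> \<eta>v)
      next
        case False
        \<comment> \<open>If \<open>v\<close> met the image of \<open>\<eta>\<close>, the pullback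
          property would produce a preimage of \<open>v\<close> under \<open>\<phi>\<close>; so
          \<open>iv None\<close> is the only value left.\<close>
        have "vmap w v \<noteq> vmap \<eta> g" if "g \<in> verts G" for g
        proof
          assume "vmap w v = vmap \<eta> g"
          then obtain k where "k \<in> verts (src \<phi>)" "vmap \<phi> k = v"
            using pullback_vertex[OF w(2), of v g] v \<open>g \<in> verts G\<close> by auto
          with False show False by auto
        qed
        then have "vmap w v = iv None"
          using vmap_in[OF wH v] by (auto simp: verts V_def \<eta>v)
        then show ?thesis using False by (simp add: gv_def)
      qed
      have we: "emap w e = ie (ge e)" if e: "e \<in> edges K" for e
      proof (cases "e \<in> emap \<phi> ` edges H")
        case True
        then obtain h where h: "h \<in> edges H" "e = emap \<phi> h" by auto
        then show ?thesis
          using comp_eqD(2)[OF comm \<phi>H \<psi>H h(1)] emap_in[OF \<psi>H h(1)] by (simp add: ge_\<phi> \<eta>e)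
      next
        case False
        have "emap w e \<noteq> emap \<eta> g" if "g \<in> edges G" for g
        proof
          assume "emap w e = emap \<eta> g"
          then obtain k where "k \<in> edges (src \<phi>)" "emap \<phi> k = e"
            using pullback_edge[OF w(2), of e g] e \<open>g \<in> edges G\<close> by auto
          with False show False by auto
        qed
        \<comment> \<open>The value is a fresh edge for the same reason, and preservation of ends
          leaves a single candidate.\<close>
        then obtain S where S: "S \<subseteq> V" "multi_edge S" "emap w e = ie (Inr S)"
          using emap_in[OF wH e] by (auto simp: edges E_def \<eta>e)
        have "iv ` S = vmap w ` ends K e"
          using ends_emap[OF wH e] S by (simp add: ends E_def en_def)
        also have "\<dots> = iv ` gv ` ends K e"
          using ends_subset[OF hK e] by (auto simp: image_image wv intro!: image_cong)
        finally have "S = gv ` ends K e"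
          using inj_on_image_eq_iff[OF iv_inj S(1)] gv_V by (auto simp: image_subset_iff)
        then show ?thesis using False S by (simp add: ge_def)
      qed
      show "w = \<theta>"
        by (rule hmor_eqI[OF wH \<theta>H]) (simp_all add: wv we \<theta>v \<theta>e)
    qed
    with \<theta>M pb show ?thesis by (auto simp: K_def)
  qed
  moreover have "monic Mult \<eta>"
    using \<eta>_inj \<eta>M by (simp add: monic_iff Arr_Mult_Hom)
  ultimately have "partial_morphism_representer Mult G \<eta>"
    by (simp add: partial_morphism_representer_def)
  then show ?thesis by (rule that)
qed

text \<open>A vertex outside the subobject may go anywhere, so some vertex must exist; an edge
  outside it must go to an edge with prescribed ends, which \<open>full\<close> supplies.\<close>

lemma Mult_injectiveI:
  fixes I :: "'u hypergraph"
  assumes mI: "multigraph I" and ne: "verts I \<noteq> {}"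
    and full: "\<And>S. S \<subseteq> verts I \<Longrightarrow> multi_edge S \<Longrightarrow> \<exists>d\<in>edges I. ends I d = S"
  shows "injective Mult I"
  unfolding injective_def Dom_Mult Cod_Mult Comp_Mult
proof (intro conjI allI impI ballI)
  show "I \<in> Ob Mult" using mI by simp
next
  fix m f :: "'u hmor" assume m: "monic Mult m" and f: "f \<in> Hom Mult (src m) I"
  define A B where "A = src m" and "B = tgt m"
  have mM: "m \<in> Hom Mult A B" and m_inj: "inj_on (vmap m) (verts A)" "inj_on (emap m) (edges A)"
    using m by (auto simp: monic_iff Arr_Mult_Hom A_def B_def)
  have fM: "f \<in> Hom Mult A I" using f by (simp add: A_def)
  note mH = Hom_Mult_Hyp[OF mM] and fH = Hom_Mult_Hyp[OF fM]
  have mB: "multigraph B" using mM by (simp add: Hom_Mult)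
  obtain v0 where v0: "v0 \<in> verts I" using ne by auto
  define gv where "gv v = (if v \<in> vmap m ` verts A then vmap f (inv_into (verts A) (vmap m) v) else v0)" for v
  define ge where "ge e = (if e \<in> emap m ` edges A then emap f (inv_into (edges A) (emap m) e)
    else SOME d. d \<in> edges I \<and> ends I d = gv ` ends B e)" for e
  have gv_m: "gv (vmap m v) = vmap f v" if "v \<in> verts A" for v
    using that m_inj by (simp add: gv_def)
  have ge_m: "ge (emap m e) = emap f e" if "e \<in> edges A" for e
    using that m_inj by (simp add: ge_def)
  have gv_in: "gv v \<in> verts I" for v
    by (auto simp: gv_def v0 intro!: vmap_in[OF fH] inv_into_into)
  have ge: "ge e \<in> edges I \<and> ends I (ge e) = gv ` ends B e" if e: "e \<in> edges B" for e
  proof (cases "e \<in> emap m ` edges A")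
    case True
    then obtain d where d: "d \<in> edges A" "e = emap m d" by auto
    have "gv ` ends B e = vmap f ` ends A d"
      using ends_subset[OF Hom_srctgt(3)[OF mH] d(1)]
      by (auto simp: d(2) ends_emap[OF mH d(1)] image_image gv_m intro!: image_cong)
    then show ?thesis using d by (simp add: ge_m ends_emap[OF fH] emap_in[OF fH])
  next
    case False
    have "\<exists>d. d \<in> edges I \<and> ends I d = gv ` ends B e"
      using full[of "gv ` ends B e"] gv_in mB e by (auto simp: multigraph_def multi_edge_image)
    then show ?thesis using False someI_ex[of "\<lambda>d. d \<in> edges I \<and> ends I d = gv ` ends B e"]
      by (simp add: ge_def)
  qed
  define g where "g = hmor_of B I gv ge"
  have gM: "g \<in> Hom Mult B I"
    unfolding g_def by (rule hmor_of_Mult[OF mB mI]) (auto simp: gv_in ge)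
  have "g \<cdot>\<^bsub>Hyp\<^esub> m = f"
    by (rule comp_eqI[OF mH Hom_Mult_Hyp[OF gM] fH])
      (simp_all add: g_def vmap_in[OF mH] emap_in[OF mH] gv_m ge_m)
  show "\<exists>g\<in>Hom Mult (tgt m) I. g \<cdot>\<^bsub>Hyp\<^esub> m = f"
    using \<open>g \<cdot>\<^bsub>Hyp\<^esub> m = f\<close> gM by (auto simp: B_def)
qed

theorem Mult_injective_envelope:
  fixes G :: "'u hypergraph"
  assumes mG: "multigraph G"
  obtains m where "injective_envelope Mult G m"
proof -
  note hG = multigraph_hypergraph[OF mG]
  fix x0 :: 'u
  \<comment> \<open>An injective multigraph has a vertex, as the map from the empty graph must
    extend to a point; thus an empty \<open>G\<close> is given the vertex \<open>x0\<close>.\<close>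
  define V where "V = (if verts G = {} then {x0} else verts G)"
  define E where "E = Inl ` edges G \<union> Inr ` {S. S \<subseteq> V \<and> multi_edge S \<and> S \<notin> ends G ` edges G}"
  define en :: "'u + 'u set \<Rightarrow> 'u set" where "en = case_sum (ends G) (\<lambda>S. S)"
  have small: "usmall U (verts G)" "usmall U (edges G)"
    using hG by (auto simp: hypergraph_def small_def usmall_def)
  have VG: "verts G \<subseteq> V" by (auto simp: V_def)
  have sV: "usmall U V"
    using small usmall_finite[of "{x0}"] by (simp add: V_def)
  have sE: "usmall U E"
    unfolding E_def
    by (intro usmall_Un usmall_image small usmall_subset[OF usmall_Pow[OF sV]]) auto
  have en_sub: "en e \<subseteq> V" if "e \<in> E" for e
    using that ends_subset[OF hG] VG by (fastforce simp: E_def en_def)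
  obtain T and iv :: "'u \<Rightarrow> 'u" and ie :: "'u + 'u set \<Rightarrow> 'u"
    where T: "hypergraph T" "bij_betw iv V (verts T)" "bij_betw ie E (edges T)"
      and ends: "\<And>e. e \<in> E \<Longrightarrow> ends T (ie e) = iv ` en e"
    by (rule hypergraph_of_types[OF sV sE, of en]) (auto intro: en_sub[THEN subsetD])
  have verts: "verts T = iv ` V" and edges: "edges T = ie ` E"
    and iv_inj: "inj_on iv V" and ie_inj: "inj_on ie E"
    using T by (auto simp: bij_betw_def)
  have en_multi: "multi_edge (en e)" if "e \<in> E" for e
    using that mG by (auto simp: E_def en_def multigraph_def)
  have mT: "multigraph T"
    using T(1) by (auto simp: multigraph_def edges ends multi_edge_image en_multi)
  define m where "m = hmor_of G T iv (\<lambda>e. ie (Inl e))"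
  have mM: "m \<in> Hom Mult G T"
    unfolding m_def using VG by (intro hmor_of_Mult[OF mG mT])
      (auto simp: verts edges E_def ends en_def)
  note mH = Hom_Mult_Hyp[OF mM]
  have mv: "vmap m v = iv v" if "v \<in> verts G" for v using that by (simp add: m_def)
  have me: "emap m e = ie (Inl e)" if "e \<in> edges G" for e using that by (simp add: m_def)
  have [simp]: "src m = G" "tgt m = T" by (simp_all add: m_def)
  have m_inj: "inj_on (vmap m) (verts G)" "inj_on (emap m) (edges G)"
  proof -
    show "inj_on (vmap m) (verts G)"
      using inj_on_subset[OF iv_inj VG] by (simp add: inj_on_def mv)
    show "inj_on (emap m) (edges G)"
      using inj_on_subset[OF ie_inj, of "Inl ` edges G"] by (auto simp: inj_on_def me E_def)
  qed
  have "injective Mult T"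
  proof (rule Mult_injectiveI[OF mT])
    show "verts T \<noteq> {}" by (auto simp: verts V_def)
  next
    fix S assume S: "S \<subseteq> verts T" "multi_edge S"
    define S' where "S' = inv_into V iv ` S"
    have S': "iv ` S' = S" "S' \<subseteq> V" "multi_edge S'"
      using S by (auto simp: S'_def verts image_inv_into_cancel multi_edge_image intro!: inv_into_into)
    show "\<exists>d\<in>edges T. ends T d = S"
    proof (cases "S' \<in> ends G ` edges G")
      case True
      then obtain e where "e \<in> edges G" "S' = ends G e" by auto
      then have "ie (Inl e) \<in> edges T" "ends T (ie (Inl e)) = S"
        using S' by (auto simp: edges E_def ends en_def)
      then show ?thesis by blast
    next
      case False
      then have "ie (Inr S') \<in> edges T" "ends T (ie (Inr S')) = S"
        using S' by (auto simp: edges E_def ends en_def)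
      then show ?thesis by blast
    qed
  qed
  moreover have "monic Mult m"
    using m_inj mM by (simp add: monic_iff Arr_Mult_Hom)
  moreover have "monic Mult f" if f: "f \<in> Arr Mult" "src f = T" and fm: "monic Mult (f \<cdot>\<^bsub>Hyp\<^esub> m)" for f
  proof -
    have fH: "f \<in> Hom Hyp T (tgt f)" using f by (auto simp: Arr_Mult_Hom Hom_Mult)
    have inj: "inj_on (vmap (f \<cdot>\<^bsub>Hyp\<^esub> m)) (verts G)" "inj_on (emap (f \<cdot>\<^bsub>Hyp\<^esub> m)) (edges G)"
      using fm by (auto simp: monic_iff)
    \<comment> \<open>For empty \<open>G\<close> the graph \<open>T\<close> has one vertex;
      otherwise all its vertices come from \<open>G\<close>.\<close>
    have v_inj: "inj_on (vmap f) (verts T)"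
    proof (cases "verts G = {}")
      case True
      then show ?thesis by (simp add: verts V_def)
    next
      case False
      then show ?thesis
        using inj(1) by (auto simp: inj_on_def verts V_def vmap_comp[OF mH] mv)
    qed
    \<comment> \<open>A fresh edge shares its set of ends with no other edge, so injectivity of
      \<open>f\<close> on vertices separates it from the rest. Two old edges are separated because
      \<open>f\<close> after \<open>m\<close> is monic.\<close>
    have new: "d = e" if "d \<in> E" "e \<in> E" "en d = en e" "d \<notin> Inl ` edges G" for d e
      using that by (auto simp: E_def en_def)
    have "inj_on (emap f) (edges T)"
    proof (rule inj_onI)
      fix x y assume xy: "x \<in> edges T" "y \<in> edges T" "emap f x = emap f y"
      then obtain d e where d: "d \<in> E" "x = ie d" and e: "e \<in> E" "y = ie e" by (auto simp: edges)
      have "vmap f ` ends T x = vmap f ` ends T y"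
        using ends_emap[OF fH] xy by metis
      then have "ends T x = ends T y"
        using inj_on_image_eq_iff[OF v_inj] ends_subset[OF T(1)] xy by metis
      then have ende: "en d = en e"
        using d e inj_on_image_eq_iff[OF iv_inj] en_sub by (simp add: ends)
      show "x = y"
      proof (cases "d \<in> Inl ` edges G \<and> e \<in> Inl ` edges G")
        case True
        then obtain d' e' where de': "d' \<in> edges G" "e' \<in> edges G" "d = Inl d'" "e = Inl e'" by auto
        then have "emap (f \<cdot>\<^bsub>Hyp\<^esub> m) d' = emap (f \<cdot>\<^bsub>Hyp\<^esub> m) e'"
          using xy(3) d e by (simp add: emap_comp[OF mH] me)
        then have "d' = e'" using inj(2) de' by (simp add: inj_on_eq_iff)
        then show ?thesis using de' d e by simp
      next
        case False
        then have "d = e" using new[OF d(1) e(1) ende] new[OF e(1) d(1) ende[symmetric]] by metis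
        then show ?thesis using d e by simp
      qed
    qed
    then show ?thesis using f v_inj by (simp add: monic_iff)
  qed
  ultimately have "injective_envelope Mult G m"
    by (auto simp: injective_envelope_def essential_mono_def)
  then show ?thesis by (rule that)
qed

end

section \<open>Negative results and the adjunction\<close>

lemma productD:
  assumes "is_product Mult A B P p q"
  shows "p \<in> Hom Mult P A" "q \<in> Hom Mult P B"
  using assms unfolding is_product_def by metis+

lemma product_pair:
  assumes "is_product Mult A B P p q" "f \<in> Hom Mult X A" "g \<in> Hom Mult X B"
  obtains u where "u \<in> Hom Mult X P" "p \<cdot>\<^bsub>Hyp\<^esub> u = f" "q \<cdot>\<^bsub>Hyp\<^esub> u = g"
proof -
  have "X \<in> Ob Mult" using assms(2) by (simp add: Hom_Mult)
  then have "\<exists>!u. u \<in> Hom Mult X P \<and> p \<cdot>\<^bsub>Hyp\<^esub> u = f \<and> q \<cdot>\<^bsub>Hyp\<^esub> u = g"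
    using assms unfolding is_product_def Comp_Mult by metis
  then show ?thesis using that by metis
qed

lemma product_eqI:
  assumes P: "is_product Mult A B P p q" and f: "f \<in> Hom Mult X P" and g: "g \<in> Hom Mult X P"
    and eq: "p \<cdot>\<^bsub>Hyp\<^esub> f = p \<cdot>\<^bsub>Hyp\<^esub> g" "q \<cdot>\<^bsub>Hyp\<^esub> f = q \<cdot>\<^bsub>Hyp\<^esub> g"
  shows "f = g"
proof -
  have "X \<in> Ob Mult" using f by (simp add: Hom_Mult)
  moreover have "p \<cdot>\<^bsub>Hyp\<^esub> f \<in> Hom Mult X A" "q \<cdot>\<^bsub>Hyp\<^esub> f \<in> Hom Mult X B"
    using comp_Mult[OF f] productD[OF P] by auto
  ultimately have "\<exists>!u. u \<in> Hom Mult X P \<and> p \<cdot>\<^bsub>Hyp\<^esub> u = p \<cdot>\<^bsub>Hyp\<^esub> f \<and> q \<cdot>\<^bsub>Hyp\<^esub> u = q \<cdot>\<^bsub>Hyp\<^esub> f"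
    using P unfolding is_product_def Comp_Mult by metis
  with f g eq show ?thesis by metis
qed

context universe
begin

lemma product_vertex_eqI:
  fixes v w :: 'u
  assumes P: "is_product Mult A B P p q" and v: "v \<in> verts P" "w \<in> verts P"
    and eq: "vmap p v = vmap p w" "vmap q v = vmap q w"
  shows "v = w"
proof -
  note pH = productD[OF P, THEN Hom_Mult_Hyp]
  have mP: "multigraph P" using productD[OF P] by (simp add: Hom_Mult)
  fix x :: 'u
  note H = point_map_Hom[OF mP v(1), of x] point_map_Hom[OF mP v(2), of x]
  note H' = H[THEN Hom_Mult_Hyp]
  have "p \<cdot>\<^bsub>Hyp\<^esub> point_map x P v = p \<cdot>\<^bsub>Hyp\<^esub> point_map x P w"
    using eq by (intro comp_eqI[OF H'(1) pH(1) comp_Hyp[OF H'(2) pH(1)]])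
      (simp_all add: vmap_comp[OF H'(2)])
  moreover have "q \<cdot>\<^bsub>Hyp\<^esub> point_map x P v = q \<cdot>\<^bsub>Hyp\<^esub> point_map x P w"
    using eq by (intro comp_eqI[OF H'(1) pH(2) comp_Hyp[OF H'(2) pH(2)]])
      (simp_all add: vmap_comp[OF H'(2)])
  ultimately have "point_map x P v = point_map x P w"
    by (rule product_eqI[OF P H])
  then show ?thesis by (metis point_map_simps)
qed

text \<open>Projections alone do not determine an edge of a product, as diagonal and antidiagonal
  share them. Equality of the ends lets both edges be probed with one ordering of ends, so that the
  probes have equal projections.\<close>

lemma product_edge_eqI:
  fixes d e :: 'u
  assumes P: "is_product Mult A B P p q" and e: "d \<in> edges P" "e \<in> edges P" "ends P d = ends P e"
    and eq: "emap p d = emap p e" "emap q d = emap q e"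
  shows "d = e"
proof -
  note pH = productD[OF P, THEN Hom_Mult_Hyp]
  have mP: "multigraph P" using productD[OF P] by (simp add: Hom_Mult)
  obtain x y :: 'u where xy: "x \<noteq> y" by (rule two_points)
  obtain a b where ab: "ends P d = {a, b}" by (rule multigraph_edgeE[OF mP e(1)])
  note H = edge_map_Hom[OF mP e(1) ab xy] edge_map_Hom[OF mP e(2) ab[unfolded e(3)] xy]
  note H' = H[THEN Hom_Mult_Hyp]
  have "p \<cdot>\<^bsub>Hyp\<^esub> edge_map x y P a b d = p \<cdot>\<^bsub>Hyp\<^esub> edge_map x y P a b e"
    using eq xy by (intro comp_eqI[OF H'(1) pH(1) comp_Hyp[OF H'(2) pH(1)]])
      (auto simp: vmap_comp[OF H'(2)] emap_comp[OF H'(2)])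
  moreover have "q \<cdot>\<^bsub>Hyp\<^esub> edge_map x y P a b d = q \<cdot>\<^bsub>Hyp\<^esub> edge_map x y P a b e"
    using eq xy by (intro comp_eqI[OF H'(1) pH(2) comp_Hyp[OF H'(2) pH(2)]])
      (auto simp: vmap_comp[OF H'(2)] emap_comp[OF H'(2)])
  ultimately have "edge_map x y P a b d = edge_map x y P a b e"
    by (rule product_eqI[OF P H])
  then show ?thesis by (metis edge_map_simps(3))
qed

text \<open>An exponential would provide a transpose \<open>g\<close> of a map \<open>f\<close> on
  the square of \<open>A\<close>. At either vertex of \<open>A\<close> the map \<open>f\<close>
  restricts to the same \<open>f1\<close>, so uniqueness of transposes forces \<open>g\<close> to
  identify the two vertices. The product of \<open>g\<close> with the identity then merges diagonal
  and antidiagonal, which \<open>f\<close> separates.\<close>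

theorem Mult_not_cartesian_closed: "\<not> cartesian_closed (Mult :: ('u hypergraph, 'u hmor) cat)"
proof
  assume cc: "cartesian_closed (Mult :: ('u hypergraph, 'u hmor) cat)"
  obtain x y :: 'u where xy: "x \<noteq> y" by (rule two_points)
  define A where "A = edge_graph x y"
  define O1 where "O1 = point_graph x"
  \<comment> \<open>Two parallel edges, so that the value on an edge of the square can be chosen
    independently of the vertex map.\<close>
  define B where "B = \<lparr>verts = {x, y}, edges = {x, y}, ends = (\<lambda>e\<in>{x, y}. {x, y})\<rparr>"
  have A: "verts A = {x, y}" "edges A = {x}" "ends A x = {x, y}" by (simp_all add: A_def)
  have mA: "multigraph A" by (simp add: A_def multigraph_edge_graph)
  have mO: "multigraph O1" by (simp add: O1_def multigraph_point_graph)
  have mB: "multigraph B"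
    by (auto simp: B_def multigraph_def hypergraph_def small_finite multi_edge_iff)
  obtain E P p q ev where exp: "is_exponential Mult A B E P p q ev"
    using cc mA mB unfolding cartesian_closed_def by (metis Ob_Mult)
  obtain Q p' q' where Q: "is_product Mult A A Q p' q'"
    using cc mA unfolding cartesian_closed_def by (metis Ob_Mult)
  obtain Q1 p1 q1 where Q1: "is_product Mult O1 A Q1 p1 q1"
    using cc mA mO unfolding cartesian_closed_def by (metis Ob_Mult)
  have P: "is_product Mult E A P p q" and ev: "ev \<in> Hom Mult P B"
    using exp unfolding is_exponential_def by blast+
  have all_transpose: "\<forall>X\<in>Ob Mult. \<forall>R r s. is_product Mult X A R r s \<longrightarrow>
      (\<forall>f\<in>Hom Mult R B. \<exists>!g. g \<in> Hom Mult X E \<and>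
        (\<exists>u\<in>Hom Mult R P. p \<cdot>\<^bsub>Hyp\<^esub> u = g \<cdot>\<^bsub>Hyp\<^esub> r \<and> q \<cdot>\<^bsub>Hyp\<^esub> u = s \<and> ev \<cdot>\<^bsub>Hyp\<^esub> u = f))"
    using exp unfolding is_exponential_def Comp_Mult by (elim conjE)
  have transpose: "\<exists>!g. g \<in> Hom Mult X E \<and>
      (\<exists>u\<in>Hom Mult R P. p \<cdot>\<^bsub>Hyp\<^esub> u = g \<cdot>\<^bsub>Hyp\<^esub> r \<and> q \<cdot>\<^bsub>Hyp\<^esub> u = s \<and> ev \<cdot>\<^bsub>Hyp\<^esub> u = f)"
    if "multigraph X" "is_product Mult X A R r s" "f \<in> Hom Mult R B" for X R r s f
    by (rule all_transpose[rule_format, OF _ that(2,3)]) (simp add: that(1))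
  note pH = productD[OF P, THEN Hom_Mult_Hyp] and p'M = productD[OF Q] and p1M = productD[OF Q1]
  note p'H = p'M[THEN Hom_Mult_Hyp] and p1H = p1M[THEN Hom_Mult_Hyp]
  \<comment> \<open>On vertices this is the second projection, which forgets the first factor; hence
    the restrictions to the two vertices of the first factor agree. On edges it tests for the
    diagonal.\<close>
  define f where "f = hmor_of Q B (vmap q')
    (\<lambda>k. if \<forall>w\<in>ends Q k. vmap p' w = vmap q' w then x else y)"
  have "ends A (emap q' k) = {x, y}" if "k \<in> edges Q" for k
    using emap_in[OF p'H(2) that] by (simp add: A)
  then have fM: "f \<in> Hom Mult Q B"
    unfolding f_def using p'M(2) mB vmap_in[OF p'H(2)] ends_emap[OF p'H(2)]
    by (intro hmor_of_Mult) (auto simp: Hom_Mult B_def A)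
  note fH = Hom_Mult_Hyp[OF fM]
  obtain g u where g: "g \<in> Hom Mult A E" and u: "u \<in> Hom Mult Q P"
    and pu: "p \<cdot>\<^bsub>Hyp\<^esub> u = g \<cdot>\<^bsub>Hyp\<^esub> p'" "q \<cdot>\<^bsub>Hyp\<^esub> u = q'" and evu: "ev \<cdot>\<^bsub>Hyp\<^esub> u = f"
    using transpose[OF mA Q fM] by metis
  note gH = Hom_Mult_Hyp[OF g] and uH = Hom_Mult_Hyp[OF u]
  \<comment> \<open>An edge of \<open>Q1\<close> would project to an edge of the point. Maps out of
    \<open>Q1\<close> are thus determined by their vertex maps.\<close>
  have noedge: "edges Q1 = {}"
    using emap_in[OF p1H(1)] by (auto simp: O1_def)
  define f1 where "f1 = hmor_of Q1 B (vmap q1) (\<lambda>_. undefined)"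
  have f1M: "f1 \<in> Hom Mult Q1 B"
    unfolding f1_def using p1M(2) mB vmap_in[OF p1H(2)]
    by (intro hmor_of_Mult) (auto simp: Hom_Mult B_def A noedge)
  have point: "point_map x A z \<in> Hom Mult O1 A" if "z \<in> {x, y}" for z
    using that mA unfolding O1_def by (intro point_map_Hom) (auto simp: A)
  have transp1: "g \<cdot>\<^bsub>Hyp\<^esub> point_map x A z \<in> Hom Mult O1 E \<and>
      (\<exists>u\<in>Hom Mult Q1 P. p \<cdot>\<^bsub>Hyp\<^esub> u = (g \<cdot>\<^bsub>Hyp\<^esub> point_map x A z) \<cdot>\<^bsub>Hyp\<^esub> p1 \<and> q \<cdot>\<^bsub>Hyp\<^esub> u = q1 \<and> ev \<cdot>\<^bsub>Hyp\<^esub> u = f1)"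
    if z: "z \<in> {x, y}" for z
  proof -
    note i = point[OF z]
    \<comment> \<open>\<open>j\<close> is the inclusion of the vertex \<open>z\<close>, times the
      identity of \<open>A\<close>, into the square.\<close>
    obtain j where j: "j \<in> Hom Mult Q1 Q" "p' \<cdot>\<^bsub>Hyp\<^esub> j = point_map x A z \<cdot>\<^bsub>Hyp\<^esub> p1" "q' \<cdot>\<^bsub>Hyp\<^esub> j = q1"
      by (rule product_pair[OF Q comp_Mult[OF p1M(1) i] p1M(2)])
    note jH = Hom_Mult_Hyp[OF j(1)]
    have "f \<cdot>\<^bsub>Hyp\<^esub> j = f1"
    proof (rule comp_eqI[OF jH fH Hom_Mult_Hyp[OF f1M]])
      fix v assume v: "v \<in> verts Q1"
      show "vmap f (vmap j v) = vmap f1 v"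
        using vmap_comp[OF jH v, of q'] vmap_in[OF jH v] v by (simp add: f_def f1_def j(3))
    qed (simp add: noedge)
    then have "ev \<cdot>\<^bsub>Hyp\<^esub> (u \<cdot>\<^bsub>Hyp\<^esub> j) = f1"
      using comp_assoc[OF jH uH Hom_Mult_Hyp[OF ev]] evu by simp
    moreover have "p \<cdot>\<^bsub>Hyp\<^esub> (u \<cdot>\<^bsub>Hyp\<^esub> j) = (g \<cdot>\<^bsub>Hyp\<^esub> point_map x A z) \<cdot>\<^bsub>Hyp\<^esub> p1"
      using comp_assoc[OF jH uH pH(1)] comp_assoc[OF jH p'H(1) gH]
        comp_assoc[OF p1H(1) Hom_Mult_Hyp[OF i] gH] pu(1) j(2) by simp
    moreover have "q \<cdot>\<^bsub>Hyp\<^esub> (u \<cdot>\<^bsub>Hyp\<^esub> j) = q1"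
      using comp_assoc[OF jH uH pH(2)] pu(2) j(3) by simp
    ultimately show ?thesis
      using comp_Mult[OF j(1) u] comp_Mult[OF i g] by blast
  qed
  have "g \<cdot>\<^bsub>Hyp\<^esub> point_map x A x = g \<cdot>\<^bsub>Hyp\<^esub> point_map x A y"
    using transpose[OF mO Q1 f1M] transp1[of x] transp1[of y] by (metis insertCI)
  then have gxy: "vmap g x = vmap g y"
    using comp_eqD(1)[OF _ Hom_Mult_Hyp[OF point] Hom_Mult_Hyp[OF point], of g x g y x]
    by (simp add: O1_def)
  have yx: "ends A x = {y, x}" by (auto simp: A)
  have idM: "edge_map x y A x y x \<in> Hom Mult A A" and swM: "edge_map x y A y x x \<in> Hom Mult A A"
    using edge_map_Hom[OF mA _ A(3) xy] edge_map_Hom[OF mA _ yx xy] by (simp_all add: A) (simp_all add: A_def)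
  \<comment> \<open>\<open>t\<close> traces the diagonal of the square; \<open>s\<close> below
    traces the antidiagonal by swapping the second coordinate.\<close>
  obtain t where t: "t \<in> Hom Mult A Q" "p' \<cdot>\<^bsub>Hyp\<^esub> t = edge_map x y A x y x" "q' \<cdot>\<^bsub>Hyp\<^esub> t = edge_map x y A x y x"
    by (rule product_pair[OF Q idM idM])
  obtain s where s: "s \<in> Hom Mult A Q" "p' \<cdot>\<^bsub>Hyp\<^esub> s = edge_map x y A x y x" "q' \<cdot>\<^bsub>Hyp\<^esub> s = edge_map x y A y x x"
    by (rule product_pair[OF Q idM swM])
  note tH = Hom_Mult_Hyp[OF t(1)] and sH = Hom_Mult_Hyp[OF s(1)]
  have xA: "x \<in> verts A" "y \<in> verts A" "x \<in> edges A" by (simp_all add: A)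
  have tv: "vmap p' (vmap t x) = x" "vmap p' (vmap t y) = y" "vmap q' (vmap t x) = x" "vmap q' (vmap t y) = y"
    "emap p' (emap t x) = x" "emap q' (emap t x) = x"
    by (simp_all add: xy vmap_comp[OF tH xA(1), symmetric] vmap_comp[OF tH xA(2), symmetric]
        emap_comp[OF tH xA(3), symmetric] t(2,3))
  have sv: "vmap p' (vmap s x) = x" "vmap p' (vmap s y) = y" "vmap q' (vmap s x) = y" "vmap q' (vmap s y) = x"
    "emap p' (emap s x) = x" "emap q' (emap s x) = x"
    by (simp_all add: xy vmap_comp[OF sH xA(1), symmetric] vmap_comp[OF sH xA(2), symmetric]
        emap_comp[OF sH xA(3), symmetric] s(2,3))
  have tQ: "vmap t x \<in> verts Q" "vmap t y \<in> verts Q" "emap t x \<in> edges Q"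
    and sQ: "vmap s x \<in> verts Q" "vmap s y \<in> verts Q" "emap s x \<in> edges Q"
    using vmap_in[OF tH] emap_in[OF tH] vmap_in[OF sH] emap_in[OF sH] by (auto simp: A)
  have tends: "ends Q (emap t x) = {vmap t x, vmap t y}" and sends: "ends Q (emap s x) = {vmap s x, vmap s y}"
    using ends_emap[OF tH, of x] ends_emap[OF sH, of x] by (auto simp: A)
  have puv: "vmap p (vmap u v) = vmap g (vmap p' v)" "vmap q (vmap u v) = vmap q' v" if "v \<in> verts Q" for v
    using comp_eqD(1)[OF pu(1) uH p'H(1) that] vmap_comp[OF uH that, of q] pu(2) by auto
  have pue: "emap p (emap u e) = emap g (emap p' e)" "emap q (emap u e) = emap q' e" if "e \<in> edges Q" for e
    using comp_eqD(2)[OF pu(1) uH p'H(1) that] emap_comp[OF uH that, of q] pu(2) by auto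
  \<comment> \<open>Corners of the square with the same second coordinate are merged by
    \<open>u\<close>, since \<open>g\<close> agrees on the two vertices. Hence the images of
    diagonal and antidiagonal get the same ends.\<close>
  have v1: "vmap u (vmap t x) = vmap u (vmap s y)"
    by (rule product_vertex_eqI[OF P]) (simp_all add: tQ sQ gxy vmap_in[OF uH] puv tv sv)
  have v2: "vmap u (vmap t y) = vmap u (vmap s x)"
    by (rule product_vertex_eqI[OF P]) (simp_all add: tQ sQ gxy vmap_in[OF uH] puv tv sv)
  have "emap u (emap t x) = emap u (emap s x)"
  proof (rule product_edge_eqI[OF P])
    show "ends P (emap u (emap t x)) = ends P (emap u (emap s x))"
      using ends_emap[OF uH tQ(3)] ends_emap[OF uH sQ(3)] by (auto simp: tends sends v1 v2)
  qed (use tQ sQ in \<open>simp_all add: emap_in[OF uH] pue tv sv\<close>)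
  then have "emap f (emap t x) = emap f (emap s x)"
    using emap_comp[OF uH tQ(3), of ev] emap_comp[OF uH sQ(3), of ev] evu by simp
  moreover have "emap f (emap t x) = x" using tQ by (simp add: f_def tends tv)
  moreover have "emap f (emap s x) = y" using sQ xy by (simp add: f_def sends sv)
  ultimately show False using xy by simp
qed

section \<open>Limits and the inclusion \<open>N\<close>\<close>

theorem N_not_continuous:
  "\<not> continuous TYPE('u) Mult Hyp (N :: ('u hypergraph, 'u hmor, 'u hypergraph, 'u hmor) func)"
proof
  assume cont: "continuous TYPE('u) Mult Hyp (N :: ('u hypergraph, 'u hmor, 'u hypergraph, 'u hmor) func)"
  fix x :: 'u
  \<comment> \<open>The empty category: a limit over it is a terminal object.\<close>
  define J :: "('u, 'u) cat" where
    "J = \<lparr>Ob = {}, Arr = {}, Dom = id, Cod = id, Id = id, Comp = (\<lambda>f g. f)\<rparr>"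
  define T where "T = edge_graph x x"
  define D :: "('u, 'u, 'u hypergraph, 'u hmor) func" where
    "D = \<lparr>FO = (\<lambda>_. T), FA = (\<lambda>_. Id Hyp T)\<rparr>"
  have T: "verts T = {x}" "edges T = {x}" "ends T x = {x}" and mT: "multigraph T"
    by (simp_all add: T_def multigraph_edge_graph)
  have J: "small_category J"
    by (auto simp: J_def small_category_def category_def Hom_def small_finite)
  moreover have "is_functor J Mult D"
    using J category_Mult by (auto simp: is_functor_def small_category_def J_def Hom_def)
  moreover have "is_limit J Mult D T (\<lambda>_. Id Hyp T)"
  proof -
    \<comment> \<open>Every edge of a multigraph has an end, so sending everything to the loop
      respects ends; an edge without ends would break this.\<close>
    have "\<exists>!u. u \<in> Hom Mult Y T" if mY: "multigraph Y" for Y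
    proof (rule ex1I)
      have ends: "ends Y e \<noteq> {}" "ends Y e \<subseteq> verts Y" if "e \<in> edges Y" for e
        using mY that ends_subset[of Y e] by (auto simp: multigraph_def multi_edge_def)
      show c: "hmor_of Y T (\<lambda>_. x) (\<lambda>_. x) \<in> Hom Mult Y T"
        using ends by (intro hmor_of_Mult[OF mY mT]) (auto simp: T image_constant_conv)
      fix u assume u: "u \<in> Hom Mult Y T"
      note uH = Hom_Mult_Hyp[OF u]
      show "u = hmor_of Y T (\<lambda>_. x) (\<lambda>_. x)"
        by (rule hmor_eqI[OF uH Hom_Mult_Hyp[OF c]])
          (use vmap_in[OF uH] emap_in[OF uH] in \<open>auto simp: T\<close>)
    qed
    then show ?thesis using mT by (simp add: is_limit_def is_cone_def J_def)
  qed
  ultimately have lim: "is_limit J Hyp (func_comp N D) (FO N T) (FA N \<circ> (\<lambda>_. Id Hyp T))"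
    using cont unfolding continuous_def by blast
  define L where "L = \<lparr>verts = {x}, edges = {x}, ends = (\<lambda>e\<in>{x}. {})\<rparr>"
  have "hypergraph L"
    by (auto simp: L_def hypergraph_def small_finite)
  then have "\<exists>u. u \<in> Hom Hyp L T"
    using lim by (auto simp: is_limit_def is_cone_def J_def N_def)
  then obtain u where u: "u \<in> Hom Hyp L T" ..
  show False
    using ends_emap[OF u, of x] emap_in[OF u, of x] by (simp add: L_def T)
qed

end

theorem N_adjoint_Del:
  "adjoint Mult Hyp (N :: ('u hypergraph, 'u hmor, 'u hypergraph, 'u hmor) func) Del"
proof -
  \<comment> \<open>A map from a multigraph hits only edges with one or two ends, so it already
    lands in \<open>del Y\<close>; the bijection merely changes the recorded target.\<close>
  define \<Phi> :: "'u hypergraph \<Rightarrow> 'u hypergraph \<Rightarrow> 'u hmor \<Rightarrow> 'u hmor" where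
    "\<Phi> X Y f = f\<lparr>tgt := del Y\<rparr>" for X Y f
  have emap_del: "emap f e \<in> del_edges Y"
    if "f \<in> Hom Hyp X Y" "multigraph X" "e \<in> edges X" for f X Y e
    using that emap_in[OF that(1,3)] ends_emap[OF that(1,3)]
    by (simp add: del_edges_def multigraph_def multi_edge_image)
  have "bij_betw (\<Phi> X Y) (Hom Hyp X Y) (Hom Mult X (del Y))" if mX: "multigraph X" and hY: "hypergraph Y" for X Y
  proof (rule bij_betw_byWitness[where f' = "\<lambda>h. h\<lparr>tgt := Y\<rparr>"])
    show "\<Phi> X Y ` Hom Hyp X Y \<subseteq> Hom Mult X (del Y)"
    proof
      fix h assume "h \<in> \<Phi> X Y ` Hom Hyp X Y"
      then obtain f where f: "f \<in> Hom Hyp X Y" "h = \<Phi> X Y f" by auto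
      have "emap f e \<in> del_edges Y" if "e \<in> edges X" for e
        using emap_del[OF f(1) mX that] .
      then show "h \<in> Hom Mult X (del Y)"
        using f mX multigraph_del[OF hY]
        by (auto simp: Hom_Mult Hom_Hyp \<Phi>_def hmorphism_def multigraph_def del_def PiE_iff)
    qed
    show "(\<lambda>h. h\<lparr>tgt := Y\<rparr>) ` Hom Mult X (del Y) \<subseteq> Hom Hyp X Y"
      using hY by (auto simp: Hom_Mult Hom_Hyp hmorphism_def del_def del_edges_def PiE_iff)
  qed (auto simp: \<Phi>_def Hom_Mult Hom_Hyp)
  moreover have "\<Phi> X' Y' (k \<cdot>\<^bsub>Hyp\<^esub> f \<cdot>\<^bsub>Hyp\<^esub> h) = FA Del k \<cdot>\<^bsub>Hyp\<^esub> \<Phi> X Y f \<cdot>\<^bsub>Hyp\<^esub> h"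
    if h: "h \<in> Hom Mult X' X" and f: "f \<in> Hom Hyp X Y" and k: "k \<in> Hom Hyp Y Y'" for X X' Y Y' h f k
  proof -
    have "emap f (emap h e) \<in> del_edges Y" if "e \<in> edges X'" for e
      using emap_del[OF f _ emap_in[OF Hom_Mult_Hyp[OF h] that]] h by (simp add: Hom_Mult)
    then show ?thesis
      using Hom_srctgt[OF Hom_Mult_Hyp[OF h]] Hom_srctgt[OF f] Hom_srctgt[OF k]
      by (intro hmor.equality) (auto simp: \<Phi>_def Del_def comp_maps compose_def fun_eq_iff)
  qed
  ultimately show ?thesis
    unfolding adjoint_def using is_functor_N is_functor_Del
    by (intro conjI exI[of _ \<Phi>]) (auto simp: N_def Del_def)
qed

context universe
begin

section \<open>Quotients and the functor \<open>Del\<close>\<close>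

lemma three_points: obtains a b c :: 'u where "a \<noteq> b" "a \<noteq> c" "b \<noteq> c"
proof -
  obtain S :: "'u set" where "card S = 3"
    using infinite_arbitrarily_large[OF infinite_universe] by blast
  then show ?thesis using that by (auto simp: card_3_iff)
qed

theorem Del_not_cocontinuous:
  "\<not> cocontinuous TYPE('u) Hyp Mult (Del :: ('u hypergraph, 'u hmor, 'u hypergraph, 'u hmor) func)"
proof
  assume cocont: "cocontinuous TYPE('u) Hyp Mult (Del :: ('u hypergraph, 'u hmor, 'u hypergraph, 'u hmor) func)"
  obtain a b c :: 'u where abc: "a \<noteq> b" "a \<noteq> c" "b \<noteq> c" by (rule three_points)
  \<comment> \<open>The group of order two as a one-object category, with identity \<open>a\<close>
    and involution \<open>b\<close>; a colimit over it is the quotient by the action of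
    \<open>\<sigma>\<close>.\<close>
  define J :: "('u, 'u) cat" where
    "J = \<lparr>Ob = {a}, Arr = {a, b}, Dom = (\<lambda>_. a), Cod = (\<lambda>_. a), Id = (\<lambda>_. a),
      Comp = (\<lambda>f g. if f = g then a else b)\<rparr>"
  define H where "H = \<lparr>verts = {a, b, c}, edges = {a}, ends = (\<lambda>e\<in>{a}. {a, b, c})\<rparr>"
  define X where "X = edge_graph a c"
  define \<sigma> where "\<sigma> = hmor_of H H (\<lambda>v. if v = a then b else if v = b then a else c) (\<lambda>e. e)"
  \<comment> \<open>The quotient map merges the orbit of \<open>a\<close> and \<open>b\<close> and
    keeps the fixed vertex \<open>c\<close>, which leaves an edge with two ends.\<close>
  define t where "t = hmor_of H X (\<lambda>v. if v = c then c else a) (\<lambda>e. e)"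
  define K :: "('u, 'u, 'u hypergraph, 'u hmor) func" where
    "K = \<lparr>FO = (\<lambda>_. H), FA = (\<lambda>f. if f = b then \<sigma> else Id Hyp H)\<rparr>"
  have H: "verts H = {a, b, c}" "edges H = {a}" "ends H a = {a, b, c}" by (simp_all add: H_def)
  have X: "verts X = {a, c}" "edges X = {a}" "ends X a = {a, c}" by (simp_all add: X_def)
  have hH: "hypergraph H" by (auto simp: H_def hypergraph_def small_finite)
  have hX: "hypergraph X" by (simp add: X_def multigraph_edge_graph multigraph_hypergraph)
  have \<sigma>: "\<sigma> \<in> Hom Hyp H H"
    unfolding \<sigma>_def using abc by (intro hmor_of_Hyp hH) (auto simp: H)
  have t: "t \<in> Hom Hyp H X"
    unfolding t_def using abc by (intro hmor_of_Hyp hH hX) (auto simp: H X)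
  have \<sigma>\<sigma>: "\<sigma> \<cdot>\<^bsub>Hyp\<^esub> \<sigma> = Id Hyp H"
    by (rule comp_eqI[OF \<sigma> \<sigma> Id_Hyp[OF hH]]) (use abc in \<open>auto simp: \<sigma>_def H\<close>)
  have t\<sigma>: "t \<cdot>\<^bsub>Hyp\<^esub> \<sigma> = t"
    by (rule comp_eqI[OF \<sigma> t t]) (use abc in \<open>auto simp: \<sigma>_def t_def H\<close>)
  have Idr: "f \<cdot>\<^bsub>Hyp\<^esub> Id Hyp H = f" if "f \<in> Hom Hyp H Y" for f Y
    using that by (rule category.Comp_Id[OF category_Hyp])
  have Idl: "Id Hyp H \<cdot>\<^bsub>Hyp\<^esub> f = f" if "f \<in> Hom Hyp Y H" for f Y
    using that by (rule category.Id_Comp[OF category_Hyp])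
  have J: "small_category J"
    using abc by (auto simp: J_def small_category_def category_def Hom_def small_finite)
  have HomJ: "f \<in> Hom J Y Z \<longleftrightarrow> Y = a \<and> Z = a \<and> f \<in> {a, b}" for f Y Z
    by (auto simp: J_def Hom_def)
  have KF: "is_functor J Hyp K"
  proof (rule is_functor.intro)
    show "category J" using J by (simp add: small_category_def)
    show "category Hyp" by (rule category_Hyp)
    show "FO K Y \<in> Ob Hyp" for Y using hH by (simp add: K_def)
    show "FA K f \<in> Hom Hyp (FO K Y) (FO K Z)" for f Y Z
      using \<sigma> Id_Hyp[OF hH] by (simp add: K_def)
    show "FA K (cat.Id J Y) = Id Hyp (FO K Y)" for Y
      using abc by (simp add: J_def K_def)
    show "FA K (g \<cdot>\<^bsub>J\<^esub> f) = FA K g \<cdot>\<^bsub>Hyp\<^esub> FA K f"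
      if "f \<in> Hom J Y Z" "g \<in> Hom J Z W" for f g Y Z W
      using that \<sigma>\<sigma> Idl[OF \<sigma>] Idr[OF \<sigma>] Idl[OF Id_Hyp[OF hH]] abc
      by (simp add: HomJ) (auto simp: J_def K_def)
  qed
  have cocone: "is_cocone J Hyp K Y s \<longleftrightarrow> hypergraph Y \<and> s a \<in> Hom Hyp H Y \<and> s a \<cdot>\<^bsub>Hyp\<^esub> \<sigma> = s a" for Y s
    using Idr[of "s a" Y] abc by (auto simp: is_cocone_def J_def K_def)
  have "is_colimit J Hyp K X (\<lambda>_. t)"
    unfolding is_colimit_def
  proof (intro conjI allI impI)
    show "is_cocone J Hyp K X (\<lambda>_. t)" using hX t t\<sigma> by (simp add: cocone)
  next
    fix Y s assume "is_cocone J Hyp K Y s"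
    then have hY: "hypergraph Y" and s: "s a \<in> Hom Hyp H Y" and s\<sigma>: "s a \<cdot>\<^bsub>Hyp\<^esub> \<sigma> = s a"
      by (auto simp: cocone)
    have sab: "vmap (s a) b = vmap (s a) a"
      using vmap_comp[OF \<sigma>, of a "s a"] by (simp add: s\<sigma> H) (simp add: \<sigma>_def H)
    have sends: "ends Y (emap (s a) a) = {vmap (s a) a, vmap (s a) c}"
      using ends_emap[OF s, of a] sab by (simp add: H)
    define u where "u = hmor_of X Y (vmap (s a)) (emap (s a))"
    have uH: "u \<in> Hom Hyp X Y"
      unfolding u_def using vmap_in[OF s] emap_in[OF s] sends
      by (intro hmor_of_Hyp hX hY) (auto simp: H X)
    have "\<exists>!u. u \<in> Hom Hyp X Y \<and> u \<cdot>\<^bsub>Hyp\<^esub> t = s a"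
    proof (intro ex1I[of _ u] conjI uH)
      show "u \<cdot>\<^bsub>Hyp\<^esub> t = s a"
        by (rule comp_eqI[OF t uH s]) (use abc sab in \<open>auto simp: u_def t_def H X\<close>)
    next
      fix w assume w: "w \<in> Hom Hyp X Y \<and> w \<cdot>\<^bsub>Hyp\<^esub> t = s a"
      then have wH: "w \<in> Hom Hyp X Y" and wt: "w \<cdot>\<^bsub>Hyp\<^esub> t = s a" by auto
      have "vmap w v = vmap (s a) v" if "v \<in> {a, c}" for v
        using that abc vmap_comp[OF t, of v w] by (auto simp: wt H) (auto simp: t_def H)
      moreover have "emap w a = emap (s a) a"
        using emap_comp[OF t, of a w] by (simp add: wt H) (simp add: t_def H)
      ultimately show "w = u"
        by (intro hmor_eqI[OF wH uH]) (auto simp: u_def X)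
    qed
    then show "\<exists>!u. u \<in> Hom Hyp X Y \<and> (\<forall>i\<in>Ob J. u \<cdot>\<^bsub>Hyp\<^esub> t = s i)" by (simp add: J_def)
  qed
  then have colim: "is_colimit J Mult (func_comp Del K) (FO Del X) (FA Del \<circ> (\<lambda>_. t))"
    using cocont J KF unfolding cocontinuous_def by blast
  have noedge: "edges (del H) = {}"
    using abc by (auto simp: del_def del_edges_def H multi_edge_def)
  \<comment> \<open>As \<open>del H\<close> is edgeless, it maps to a point, compatibly with the
    action. The alleged colimit \<open>del X\<close> has an edge, which no map can send to a graph
    without edges.\<close>
  define s where "s = hmor_of (del H) (point_graph a) (\<lambda>_. a) (\<lambda>_. undefined)"
  have sM: "s \<in> Hom Mult (del H) (point_graph a)"
    unfolding s_def by (intro hmor_of_Mult multigraph_del hH multigraph_point_graph) (auto simp: noedge)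
  note sH = Hom_Mult_Hyp[OF sM]
  have FK: "FA Del (FA K f) \<in> Hom Hyp (del H) (del H)" for f
    using is_functor.FA_Hom[OF is_functor_Del, of "FA K f" H H] \<sigma> Id_Hyp[OF hH]
    by (auto simp: K_def Del_def Hom_Mult)
  have "s \<cdot>\<^bsub>Hyp\<^esub> FA Del (FA K f) = s" for f
    by (rule comp_eqI[OF FK[of f] sH sH]) (use vmap_in[OF FK[of f]] in \<open>auto simp: noedge s_def\<close>)
  then have "is_cocone J Mult (func_comp Del K) (point_graph a) (\<lambda>_. s)"
    using sM multigraph_point_graph[of a] by (auto simp: is_cocone_def func_comp_def K_def Del_def)
  then have "\<exists>!u. u \<in> Hom Mult (FO Del X) (point_graph a) \<and> (\<forall>i\<in>Ob J. u \<cdot>\<^bsub>Hyp\<^esub> (FA Del \<circ> (\<lambda>_. t)) i = s)"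
    using colim unfolding is_colimit_def Comp_Mult by blast
  then obtain u where "u \<in> Hom Hyp (del X) (point_graph a)"
    by (auto simp: Hom_Mult Del_def)
  moreover have "multi_edge {a, c}" unfolding multi_edge_iff by blast
  ultimately show False
    using emap_in[of u "del X" "point_graph a" a] by (simp add: del_def del_edges_def X)
qed

end

theorem mainTheorem9:
  assumes "universe_type TYPE('u)"
  shows "complete TYPE('u) (Mult :: ('u hypergraph, 'u hmor) cat)
    \<and> cocomplete TYPE('u) (Mult :: ('u hypergraph, 'u hmor) cat)
    \<and> regular (Mult :: ('u hypergraph, 'u hmor) cat)
    \<and> (\<forall>G \<in> Ob (Mult :: ('u hypergraph, 'u hmor) cat).
         \<exists>\<eta>. partial_morphism_representer Mult G \<eta>)
    \<and> (\<forall>G \<in> Ob (Mult :: ('u hypergraph, 'u hmor) cat). \<exists>m. injective_envelope Mult G m)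
    \<and> \<not> cartesian_closed (Mult :: ('u hypergraph, 'u hmor) cat)
    \<and> \<not> continuous TYPE('u) Mult Hyp (N :: ('u hypergraph, 'u hmor, 'u hypergraph, 'u hmor) func)
    \<and> adjoint Mult Hyp (N :: ('u hypergraph, 'u hmor, 'u hypergraph, 'u hmor) func) Del
    \<and> \<not> cocontinuous TYPE('u) Hyp Mult
         (Del :: ('u hypergraph, 'u hmor, 'u hypergraph, 'u hmor) func)"
proof -
  interpret universe "TYPE('u)"
    by unfold_locales (rule assms)
  have U: "usmall TYPE('u) A" if "small A" for A :: "'u set"
    using that by (simp add: small_def usmall_def)
  have "complete TYPE('u) (Mult :: ('u hypergraph, 'u hmor) cat)"
    unfolding complete_def
  proof (intro allI impI)
    fix J :: "('u, 'u) cat" and D :: "('u, 'u, 'u hypergraph, 'u hmor) func"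
    assume JD: "small_category J \<and> is_functor J Mult D"
    then have "is_diagram J Mult D" "usmall TYPE('u) (Ob J)"
      by (simp_all add: is_functor_diagram small_category_def U)
    then show "\<exists>X t. is_limit J Mult D X t" by (metis Mult_limit)
  qed
  moreover have "cocomplete TYPE('u) (Mult :: ('u hypergraph, 'u hmor) cat)"
    unfolding cocomplete_def
  proof (intro allI impI)
    fix J :: "('u, 'u) cat" and D :: "('u, 'u, 'u hypergraph, 'u hmor) func"
    assume JD: "small_category J \<and> is_functor J Mult D"
    then have "is_diagram J Mult D" "usmall TYPE('u) (Ob J)"
      by (simp_all add: is_functor_diagram small_category_def U)
    then show "\<exists>X t. is_colimit J Mult D X t" by (metis Mult_colimit)
  qed
  moreover have "\<forall>G\<in>Ob (Mult :: ('u hypergraph, 'u hmor) cat). \<exists>\<eta>. partial_morphism_representer Mult G \<eta>"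
    by (metis Mult_partial_morphism_representer Ob_Mult)
  moreover have "\<forall>G\<in>Ob (Mult :: ('u hypergraph, 'u hmor) cat). \<exists>m. injective_envelope Mult G m"
    by (metis Mult_injective_envelope Ob_Mult)
  ultimately show ?thesis
    using Mult_regular Mult_not_cartesian_closed N_not_continuous N_adjoint_Del Del_not_cocontinuous
    by (intro conjI)
qed

end
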